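(* Let $A=(A_{i,j})_{i,j\in\mathbb Z}$ be a complex matrix such that for every $i\in\mathbb Z$, $A_{i,j}=0$ for $j\ll0$. For any $\lambda\in\mathbb Z^l$ let $$\tilde Q_\lambda=\tilde\Gamma_{-\lambda_1}\cdots\tilde\Gamma_{-\lambda_l}(1)=\sum_{\alpha\in\mathbb Z^l}A_{-\lambda_1,-\alpha_1}\cdots A_{-\lambda_l,-\alpha_l}\,Q_\alpha,\qquad\tilde\Gamma_i=\sum_{j\in\mathbb Z}A_{i,j}\varphi_j,$$ where $\varphi(u)=\sum_{j\in\mathbb Z}\varphi_ju^{-j}=E(u)H(u)E^\perp(-u)$ acts on $\mathcal B_{odd}=\mathbb C[p_1,p_3,p_5,\dots]$. a) $\tilde Q_\lambda$ is a polynomial tau-function of the BKP hierarchy. Any polynomial tau-function of the BKP hierarchy can be written in the form $\tilde Q_\lambda$ for an appropriate choice of the matrix $A$ (and of $l$ and $\lambda\in\mathbb Z^l$). b) If $A$ is invertible and $g_k(u)=\sum_{r\in\mathbb Z}(A^{-1})_{-r,-k}u^r$, then any coefficient $\tilde Q_\lambda$ of the re-expansion of the generating function of Schur $Q$-functions $$\mathcal Q(u_1,\dots,u_l)=\sum_{\lambda\in\mathbb Z^l}\tilde Q_\lambda\,g_{\lambda_1}(u_1)\cdots g_{\lambda_l}(u_l)$$ is a polynomial tau-function of the BKP hierarchy.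
   Context: $\Lambda=\mathbb C[p_1,p_2,\dots]$ is the ring of symmetric functions; $h_k,e_k$ are the complete and elementary symmetric functions; $f^\perp$ is the adjoint of multiplication by $f$ for the scalar product in which Schur functions are orthonormal ($p_n^\perp=n\,\partial/\partial p_n$). $H(u)=\sum_{k\ge0}h_ku^k$, $E(u)=\sum_{k\ge0}e_ku^k$, $E^\perp(u)=\sum_{k\ge0}e_k^\perp u^{-k}$. The operators $\varphi_j$ preserve $\mathcal B_{odd}$, satisfy $\varphi_m\varphi_n+\varphi_n\varphi_m=2(-1)^m\delta_{m+n,0}$ there, and for each $b$, $\varphi_j(b)=0$ for $j\gg0$. Put $Q(u)=E(u)H(u)$ and $$\mathcal Q(u_1,\dots,u_l)=\varphi(u_1)\cdots\varphi(u_l)(1)=\prod_{1\le i<j\le l}\Big(1+2\sum_{s\ge1}(-1)^s\big(\tfrac{u_j}{u_i}\big)^s\Big)\prod_{i=1}^lQ(u_i)=\sum_{\alpha\in\mathbb Z^l}Q_\alpha u_1^{\alpha_1}\cdots u_l^{\alpha_l}.$$ The sum defining $\tilde Q_\lambda$ has finitely many non-zero terms. BKP hierarchy: let $\Omega=\sum_{n\in\mathbb Z}\varphi_n\otimes(-1)^n\varphi_{-n}$. A polynomial tau-function of the BKP hierarchy is a non-zero $\tau\in\mathcal B_{odd}$ satisfying the bilinear BKP identity $\Omega(\tau\otimes\tau)=\tau\otimes\tau$. $B=(B_{i,j})_{i,j\in\mathbb Z}$ is the (left) inverse of $A$, written $B=A^{-1}$, if $\sum_{k\in\mathbb Z}B_{i,k}A_{k,j}=\delta_{i,j}$;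 $A$ is invertible if it has such an inverse.
   Formalization: Q̃_λ is claimed to be a tau-function only when non-zero (A=0 gives Q̃_λ=0); in b) the sum over λ∈Z^l, which may fail to exist for a left inverse, is proved as an iterated sum over λ_1, then λ_2, ..., and as a full sum for each coefficient of u^r where that sum exists. *)

theory Defs
  imports Complex_Main "HOL-Library.Poly_Mapping"
    "HOL-Computational_Algebra.Formal_Power_Series"
begin

section \<open>The ring of symmetric functions\<close>

text \<open>
  Elements of the ring \<open>\<Lambda> = \<complex>[p\<^sub>1, p\<^sub>2, \<dots>]\<close> are finitely supported families of coefficients indexed
  by monomials. Variables of the polynomial ring are numbered from 0, so that variable number \<open>i\<close>
  is the power sum \<open>p\<^bsub>i+1\<^esub>\<close>.
\<close>

abbreviation "keys \<equiv> Poly_Mapping.keys"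
abbreviation "lookup \<equiv> Poly_Mapping.lookup"

type_synonym monom = "nat \<Rightarrow>\<^sub>0 nat"
type_synonym sym = "monom \<Rightarrow>\<^sub>0 complex"

definition scale :: "complex \<Rightarrow> ('k \<Rightarrow>\<^sub>0 complex) \<Rightarrow> ('k \<Rightarrow>\<^sub>0 complex)"
  where "scale c f = Poly_Mapping.map ((*) c) f"

text \<open>The power sum \<open>p\<^sub>n\<close>; only meaningful for \<open>n \<ge> 1\<close>.\<close>

definition power_sum :: "nat \<Rightarrow> sym"
  where "power_sum n = Poly_Mapping.single (Poly_Mapping.single (n - 1) 1) 1"

text \<open>Variable number \<open>i\<close> is \<open>p\<^bsub>i+1\<^esub>\<close>, hence the condition on \<open>Suc i\<close>.\<close>

definition B_odd :: "sym set"
  where "B_odd = {f. \<forall>m \<in> keys f. \<forall>i \<in> keys m. odd (Suc i)}"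

text \<open>Exponential of a power series without constant term.\<close>

definition exp_series :: "sym fps \<Rightarrow> sym fps"
  where "exp_series F = fps_compose (Abs_fps (\<lambda>k. scale (1 / fact k) 1)) F"

text \<open>
  \<open>H(u) = exp (\<Sum>n\<ge>1. p\<^sub>n u\<^sup>n / n)\<close> and \<open>E(u) = exp (\<Sum>n\<ge>1. (-1)\<^bsup>n-1\<^esup> p\<^sub>n u\<^sup>n / n)\<close>
\<close>

definition H_series :: "sym fps"
  where "H_series = exp_series (Abs_fps (\<lambda>n. if n = 0 then 0 else scale (1 / of_nat n) (power_sum n)))"

definition E_series :: "sym fps"
  where "E_series = exp_series
     (Abs_fps (\<lambda>n. if n = 0 then 0 else scale ((-1) ^ (n - 1) / of_nat n) (power_sum n)))"

abbreviation h_sym :: "nat \<Rightarrow> sym" where "h_sym k \<equiv> fps_nth H_series k"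
abbreviation e_sym :: "nat \<Rightarrow> sym" where "e_sym k \<equiv> fps_nth E_series k"

definition Q_series :: "sym fps"
  where "Q_series = E_series * H_series"


section \<open>The scalar product and adjoint operators\<close>

text \<open>
  For the monomial \<open>p\<^sub>\<lambda>\<close>, where the part \<open>i + 1\<close> of \<open>\<lambda>\<close> occurs \<open>lookup m i\<close> times, \<open>z_factor m\<close> is
  the number \<open>z\<^sub>\<lambda> = (\<Prod>j. j\<^bsup>m\<^sub>j\<^esup> m\<^sub>j!)\<close>. The scalar product for which the Schur functions are
  orthonormal is the bilinear form with \<open>\<langle>p\<^sub>\<lambda>, p\<^sub>\<mu>\<rangle> = z\<^sub>\<lambda> \<delta>\<^bsub>\<lambda>\<mu>\<^esub>\<close>.
\<close>

definition z_factor :: "monom \<Rightarrow> nat"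
  where "z_factor m = (\<Prod>i \<in> keys m. Suc i ^ lookup m i * fact (lookup m i))"

definition hall :: "sym \<Rightarrow> sym \<Rightarrow> complex"
  where "hall f g = (\<Sum>m \<in> keys f. of_nat (z_factor m) * lookup f m * lookup g m)"

definition perp :: "sym \<Rightarrow> sym \<Rightarrow> sym"
  where "perp f g = (THE k. \<forall>h. hall k h = hall g (f * h))"


section \<open>Neutral fermions\<close>

text \<open>
  \<open>\<phi>\<^sub>j\<close> is the coefficient of \<open>u\<^bsup>-j\<^esup>\<close> in \<open>\<phi>(u) = E(u) H(u) E\<^sup>\<bottom>(-u)\<close>, where
  \<open>E\<^sup>\<bottom>(-u) = (\<Sum>k. (-1)\<^sup>k e\<^sub>k\<^sup>\<bottom> u\<^bsup>-k\<^esup>)\<close>: the terms \<open>u\<^sup>n\<close> of \<open>Q(u)\<close> and \<open>u\<^bsup>-k\<^esup>\<close> of \<open>E\<^sup>\<bottom>(-u)\<close> contribute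
  if \<open>n = k - j\<close>. The sum is finite by \<open>finite_phi_support\<close> below.
\<close>

definition phi :: "int \<Rightarrow> sym \<Rightarrow> sym"
  where "phi j f = Sum_any (\<lambda>k::nat.
     if j \<le> int k then scale ((-1) ^ k) (fps_nth Q_series (nat (int k - j)) * perp (e_sym k) f) else 0)"

text \<open>
  The coefficient \<open>Q\<^sub>\<alpha>\<close> of \<open>u\<^sub>1\<^bsup>\<alpha>\<^sub>1\<^esup> \<cdots> u\<^sub>l\<^bsup>\<alpha>\<^sub>l\<^esup>\<close> in \<open>\<phi>(u\<^sub>1) \<cdots> \<phi>(u\<^sub>l)(1)\<close>. Elements of \<open>\<int>\<^sup>l\<close> are
  integer lists of length \<open>l\<close>.
\<close>

definition Q_coeff :: "int list \<Rightarrow> sym"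
  where "Q_coeff \<alpha> = foldr (\<lambda>a f. phi (- a) f) \<alpha> 1"

definition rows_bounded_below :: "(int \<Rightarrow> int \<Rightarrow> complex) \<Rightarrow> bool"
  where "rows_bounded_below A \<longleftrightarrow> (\<forall>i. \<exists>N. \<forall>j < N. A i j = 0)"

text \<open>A finite sum if the rows of \<open>A\<close> are bounded below, see \<open>finite_Gamma_support\<close>.\<close>

definition Gamma_op :: "(int \<Rightarrow> int \<Rightarrow> complex) \<Rightarrow> int \<Rightarrow> sym \<Rightarrow> sym"
  where "Gamma_op A i f = Sum_any (\<lambda>j. scale (A i j) (phi j f))"

definition Q_tilde :: "(int \<Rightarrow> int \<Rightarrow> complex) \<Rightarrow> int list \<Rightarrow> sym"
  where "Q_tilde A ls = foldr (\<lambda>l f. Gamma_op A (- l) f) ls 1"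


section \<open>The BKP hierarchy\<close>

text \<open>
  \<open>\<Lambda> \<otimes> \<Lambda>\<close> has the tensor products of monomials as a basis, so its elements are
  finitely supported families indexed by pairs of monomials.
\<close>

type_synonym sym_tensor = "(monom \<times> monom) \<Rightarrow>\<^sub>0 complex"

definition tensor :: "sym \<Rightarrow> sym \<Rightarrow> sym_tensor"
  where "tensor f g = (\<Sum>m \<in> keys f. \<Sum>n \<in> keys g.
     Poly_Mapping.single (m, n) (lookup f m * lookup g n))"

text \<open>The operator \<open>F \<otimes> G\<close> for linear operators \<open>F\<close> and \<open>G\<close>.\<close>

definition tensor_op :: "(sym \<Rightarrow> sym) \<Rightarrow> (sym \<Rightarrow> sym) \<Rightarrow> sym_tensor \<Rightarrow> sym_tensor"
  where "tensor_op F G t = (\<Sum>k \<in> keys t. scale (lookup t k)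
     (tensor (F (Poly_Mapping.single (fst k) 1)) (G (Poly_Mapping.single (snd k) 1))))"

definition Omega :: "sym_tensor \<Rightarrow> sym_tensor"
  where "Omega t = Sum_any (\<lambda>n::int. tensor_op (phi n) (\<lambda>g. scale ((-1) powi n) (phi (- n) g)) t)"

definition BKP_tau :: "sym \<Rightarrow> bool"
  where "BKP_tau \<tau> \<longleftrightarrow> \<tau> \<in> B_odd \<and> \<tau> \<noteq> 0 \<and> Omega (tensor \<tau> \<tau>) = tensor \<tau> \<tau>"


section \<open>Infinite matrices and formal sums\<close>

definition has_finite_sum :: "('i \<Rightarrow> 'a::comm_monoid_add) \<Rightarrow> 'i set \<Rightarrow> 'a \<Rightarrow> bool"
  where "has_finite_sum f I S \<longleftrightarrow> finite {i \<in> I. f i \<noteq> 0} \<and> S = sum f {i \<in> I. f i \<noteq> 0}"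

definition left_inverse :: "(int \<Rightarrow> int \<Rightarrow> complex) \<Rightarrow> (int \<Rightarrow> int \<Rightarrow> complex) \<Rightarrow> bool"
  where "left_inverse B A \<longleftrightarrow>
     (\<forall>i j. has_finite_sum (\<lambda>k. B i k * A k j) UNIV (if i = j then 1 else 0))"

text \<open>
  Infinite sums of polynomials are understood coefficientwise: a family is summable if every
  monomial occurs in only finitely many of its members.
\<close>

definition formally_summable :: "('i \<Rightarrow> sym) \<Rightarrow> 'i set \<Rightarrow> bool"
  where "formally_summable f I \<longleftrightarrow> (\<forall>m. finite {i \<in> I. lookup (f i) m \<noteq> 0})"

definition has_formal_sum :: "('i \<Rightarrow> sym) \<Rightarrow> 'i set \<Rightarrow> sym \<Rightarrow> bool"
  where "has_formal_sum f I S \<longleftrightarrow> (\<forall>m. has_finite_sum (\<lambda>i. lookup (f i) m) I (lookup S m))"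

text \<open>
  The iterated formal sum of \<open>f [k\<^sub>1, \<dots>, k\<^sub>l]\<close> over \<open>\<int>\<^sup>l\<close>, with \<open>k\<^sub>1\<close> the innermost and \<open>k\<^sub>l\<close> the
  outermost summation index. It may exist for families that are not summable over \<open>\<int>\<^sup>l\<close>: a left
  inverse of a matrix with rows bounded below need not have finitely supported rows.
\<close>

fun has_iterated_sum :: "nat \<Rightarrow> (int list \<Rightarrow> sym) \<Rightarrow> sym \<Rightarrow> bool" where
  "has_iterated_sum 0 f S \<longleftrightarrow> f [] = S"
| "has_iterated_sum (Suc l) f S \<longleftrightarrow>
     (\<exists>T. (\<forall>k. has_iterated_sum l (\<lambda>ks. f (ks @ [k])) (T k)) \<and> has_formal_sum T UNIV S)"

text \<open>
  The formal series \<open>g\<^sub>k(u) = (\<Sum>r. B\<^bsub>-r,-k\<^esub> u\<^sup>r)\<close>, represented by its coefficients, and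
  the coefficient of \<open>u\<^sub>1\<^bsup>r\<^sub>1\<^esup> \<cdots> u\<^sub>l\<^bsup>r\<^sub>l\<^esup>\<close> in \<open>g\<^bsub>\<lambda>\<^sub>1\<^esub>(u\<^sub>1) \<cdots> g\<^bsub>\<lambda>\<^sub>l\<^esub>(u\<^sub>l)\<close>.
\<close>

definition g_coeff :: "(int \<Rightarrow> int \<Rightarrow> complex) \<Rightarrow> int \<Rightarrow> int \<Rightarrow> complex"
  where "g_coeff B k r = B (- r) (- k)"

definition g_prod_coeff :: "(int \<Rightarrow> int \<Rightarrow> complex) \<Rightarrow> int list \<Rightarrow> int list \<Rightarrow> complex"
  where "g_prod_coeff B ls rs = (\<Prod>i < length ls. g_coeff B (ls ! i) (rs ! i))"


section \<open>Well-definedness\<close>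

lemma lookup_scale [simp]: "lookup (scale c f) m = c * lookup f m"
  by (simp add: scale_def Poly_Mapping.map.rep_eq when_def)

lemma scale_0 [simp]: "scale c 0 = 0"
  by (rule poly_mapping_eqI) simp

lemma scale_zero [simp]: "scale 0 f = 0"
  by (rule poly_mapping_eqI) simp

lemma z_factor_nonzero: "z_factor m \<noteq> 0"
  by (simp add: z_factor_def)

lemma hall_superset:
  assumes "finite S" "keys f \<subseteq> S"
  shows "hall f g = (\<Sum>m \<in> S. of_nat (z_factor m) * lookup f m * lookup g m)"
  unfolding hall_def by (rule sum.mono_neutral_left) (use assms in \<open>auto simp: in_keys_iff\<close>)

lemma hall_commute: "hall f g = hall g f"
  by (simp add: hall_superset[of "keys f \<union> keys g"] mult_ac)

lemma hall_add_right: "hall f (g + h) = hall f g + hall f h"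
  by (simp add: hall_def lookup_add distrib_left sum.distrib)

lemma hall_sum_right: "hall f (sum g I) = (\<Sum>i\<in>I. hall f (g i))"
  by (induction I rule: infinite_finite_induct) (auto simp: hall_add_right, simp_all add: hall_def)

lemma hall_single: "hall f (Poly_Mapping.single m c) = of_nat (z_factor m) * lookup f m * c"
  by (subst hall_commute) (simp add: hall_def)

lemma sym_expand: "f = (\<Sum>m \<in> keys f. Poly_Mapping.single m (lookup f m))" for f :: sym
  by (rule poly_mapping_eqI) (auto simp: lookup_sum lookup_single when_def in_keys_iff)

lemma hall_eqI:
  assumes "\<And>h. hall f h = hall g h"
  shows "f = g"
proof (rule poly_mapping_eqI)
  fix m
  show "lookup f m = lookup g m"
    using assms[of "Poly_Mapping.single m 1"] z_factor_nonzero[of m] by (simp add: hall_single)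
qed

lemma perp_adjoint: "hall (perp f g) h = hall g (f * h)"
proof -
  define c where "c m = hall g (f * Poly_Mapping.single m 1) / of_nat (z_factor m)" for m
  have fin: "finite {m. c m \<noteq> 0}"
  proof (rule finite_subset)
    show "{m. c m \<noteq> 0} \<subseteq> (\<Union>a \<in> keys f. \<Union>b \<in> keys g. {b - a})"
    proof
      fix m assume "m \<in> {m. c m \<noteq> 0}"
      then have "hall g (f * Poly_Mapping.single m 1) \<noteq> 0" by (auto simp: c_def)
      then obtain b where b: "b \<in> keys g" "lookup (f * Poly_Mapping.single m 1) b \<noteq> 0"
        unfolding hall_def by (metis (no_types, lifting) mult_zero_right sum.neutral)
      then have "b \<in> keys (f * Poly_Mapping.single m 1)" by (simp add: in_keys_iff)
      then obtain a where "a \<in> keys f" "b = a + m" using keys_mult by fastforce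
      then show "m \<in> (\<Union>a \<in> keys f. \<Union>b \<in> keys g. {b - a})"
        using b(1) by force
    qed
  qed simp
  define k where "k = Abs_poly_mapping c"
  have lk: "lookup k m = c m" for m using fin by (simp add: k_def)
  have k: "hall k h = hall g (f * h)" for h
  proof -
    have "hall k (Poly_Mapping.single m x) = hall g (f * Poly_Mapping.single m x)" for m x
    proof -
      have "hall g (f * Poly_Mapping.single m x) = x * hall g (f * Poly_Mapping.single m 1)"
      proof -
        have "Poly_Mapping.single m x = Poly_Mapping.single 0 x * Poly_Mapping.single m (1::complex)"
          by (simp add: mult_single)
        then have "f * Poly_Mapping.single m x = scale x (f * Poly_Mapping.single m 1)"
          by (simp add: scale_def mult_map_scale_conv_mult mult_ac)
        then show ?thesis by (simp add: hall_def sum_distrib_left mult_ac)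
      qed
      then show ?thesis using z_factor_nonzero[of m] by (simp add: hall_single lk c_def)
    qed
    then have "hall k (\<Sum>m \<in> keys h. Poly_Mapping.single m (lookup h m)) =
        hall g (f * (\<Sum>m \<in> keys h. Poly_Mapping.single m (lookup h m)))"
      by (simp add: hall_sum_right sum_distrib_left)
    then show ?thesis using sym_expand[of h] by simp
  qed
  have "\<forall>h. hall (perp f g) h = hall g (f * h)"
    unfolding perp_def
  proof (rule theI[of _ k])
    show "\<forall>h. hall k h = hall g (f * h)" using k by blast
    show "k' = k" if "\<forall>h. hall k' h = hall g (f * h)" for k'
      by (rule hall_eqI) (use that k in simp)
  qed
  then show ?thesis by blast
qed

lemma lookup_perp:
  "lookup (perp f g) m = hall g (f * Poly_Mapping.single m 1) / of_nat (z_factor m)"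
  using perp_adjoint[of f g "Poly_Mapping.single m 1"] z_factor_nonzero[of m]
  by (simp add: hall_single field_simps)

lemma z_factor_add_single:
  "z_factor (Poly_Mapping.single i 1 + m) = Suc i * Suc (lookup m i) * z_factor m"
proof -
  let ?m' = "Poly_Mapping.single i 1 + m"
  let ?K = "insert i (keys m)"
  have sup: "z_factor n = (\<Prod>j \<in> ?K. Suc j ^ lookup n j * fact (lookup n j))"
    if "keys n \<subseteq> ?K" for n
    unfolding z_factor_def by (rule prod.mono_neutral_left) (use that in \<open>auto simp: in_keys_iff\<close>)
  have k: "keys ?m' \<subseteq> ?K" by (auto simp: in_keys_iff lookup_add lookup_single when_def split: if_splits)
  have "(\<Prod>j \<in> keys m - {i}. Suc j ^ lookup ?m' j * fact (lookup ?m' j)) =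
      (\<Prod>j \<in> keys m - {i}. Suc j ^ lookup m j * fact (lookup m j))"
    by (rule prod.cong) (auto simp: lookup_add lookup_single when_def)
  then show ?thesis
    unfolding sup[OF k] sup[OF subset_insertI]
    by (simp add: prod.insert_remove lookup_add algebra_simps)
qed

text \<open>\<open>p\<^sub>n\<^sup>\<bottom> = n \<partial>/\<partial>p\<^sub>n\<close>, coefficientwise\<close>

lemma lookup_perp_power_sum:
  "lookup (perp (power_sum (Suc i)) g) m =
     of_nat (Suc i) * (of_nat (Suc (lookup m i)) * lookup g (Poly_Mapping.single i 1 + m))"
proof -
  have "lookup (perp (power_sum (Suc i)) g) m =
      of_nat (z_factor (Poly_Mapping.single i 1 + m)) * lookup g (Poly_Mapping.single i 1 + m)
      / of_nat (z_factor m)"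
    by (simp add: lookup_perp power_sum_def mult_single hall_single)
  also have "\<dots> = of_nat (Suc i) * of_nat (Suc (lookup m i)) * of_nat (z_factor m)
      * lookup g (Poly_Mapping.single i 1 + m) / of_nat (z_factor m)"
    unfolding z_factor_add_single of_nat_mult ..
  also have "\<dots> = of_nat (Suc i) * (of_nat (Suc (lookup m i)) * lookup g (Poly_Mapping.single i 1 + m))"
    using z_factor_nonzero[of m] by (simp del: of_nat_Suc One_nat_def)
  finally show ?thesis .
qed

definition weight :: "monom \<Rightarrow> nat"
  where "weight m = (\<Sum>i \<in> keys m. Suc i * lookup m i)"

lemma weight_superset: "finite S \<Longrightarrow> keys m \<subseteq> S \<Longrightarrow> weight m = (\<Sum>i \<in> S. Suc i * lookup m i)"
  unfolding weight_def by (rule sum.mono_neutral_left) (auto simp: in_keys_iff)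

lemma weight_add: "weight (m + n) = weight m + weight n"
  using keys_add[of m n]
  by (simp add: weight_superset[of "keys m \<union> keys n"] lookup_add algebra_simps sum.distrib)

definition graded :: "sym fps \<Rightarrow> bool"
  where "graded F \<longleftrightarrow> (\<forall>n. \<forall>m \<in> keys (fps_nth F n). weight m = n)"

lemma keys_scale: "keys (scale c f) \<subseteq> keys f"
  by (auto simp: in_keys_iff)

lemma graded_mult:
  assumes "graded F" "graded G"
  shows "graded (F * G)"
  unfolding graded_def
proof (intro allI ballI)
  fix n m assume "m \<in> keys (fps_nth (F * G) n)"
  then obtain i where i: "i \<le> n" "m \<in> keys (fps_nth F i * fps_nth G (n - i))"
    unfolding fps_mult_nth using keys_sum by fastforce
  then obtain a b where "a \<in> keys (fps_nth F i)" "b \<in> keys (fps_nth G (n - i))" "m = a + b"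
    using keys_mult by blast
  then show "weight m = n" using assms i(1) unfolding graded_def by (metis weight_add le_add_diff_inverse)
qed

lemma graded_1: "graded 1"
  by (auto simp: graded_def weight_def)

lemma graded_power: "graded F \<Longrightarrow> graded (F ^ k)"
  by (induction k) (auto intro: graded_mult graded_1)

lemma graded_exp_series:
  assumes "graded F"
  shows "graded (exp_series F)"
  unfolding graded_def
proof (intro allI ballI)
  fix n m assume "m \<in> keys (fps_nth (exp_series F) n)"
  then obtain i where "m \<in> keys (scale (1 / fact i) 1 * fps_nth (F ^ i) n)"
    unfolding exp_series_def fps_compose_nth using keys_sum by fastforce
  moreover have "scale (1 / fact i) 1 * fps_nth (F ^ i) n = scale (1 / fact i) (fps_nth (F ^ i) n)"
    by (simp add: scale_def mult_map_scale_conv_mult)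
  ultimately have "m \<in> keys (fps_nth (F ^ i) n)" using keys_scale by fastforce
  then show "weight m = n" using graded_power[OF assms, of i] by (auto simp: graded_def)
qed

lemma graded_power_sums:
  "graded (Abs_fps (\<lambda>n. if n = 0 then 0 else scale (c n) (power_sum n)))"
  unfolding graded_def
proof (intro allI ballI)
  fix n m
  assume *: "m \<in> keys (fps_nth (Abs_fps (\<lambda>n. if n = 0 then 0 else scale (c n) (power_sum n))) n)"
  then have "n \<noteq> 0" "m \<in> keys (power_sum n)"
    using subsetD[OF keys_scale] by (auto split: if_splits simp del: neq0_conv)
  then show "weight m = n" by (auto simp: power_sum_def weight_def)
qed

lemma graded_E: "graded E_series" and graded_H: "graded H_series"
  unfolding E_series_def H_series_def by (rule graded_exp_series[OF graded_power_sums])+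

lemma perp_e_eq_0:
  assumes "\<And>m. m \<in> keys f \<Longrightarrow> weight m < k"
  shows "perp (e_sym k) f = 0"
proof (rule poly_mapping_eqI)
  fix m
  have "lookup (e_sym k * Poly_Mapping.single m 1) b = 0" if "b \<in> keys f" for b
  proof (rule ccontr)
    assume "lookup (e_sym k * Poly_Mapping.single m 1) b \<noteq> 0"
    then have "b \<in> keys (e_sym k * Poly_Mapping.single m 1)" by (simp add: in_keys_iff)
    then obtain a where "a \<in> keys (e_sym k)" "b = a + m" using keys_mult by fastforce
    moreover from this have "weight a = k" using graded_E by (auto simp: graded_def)
    ultimately show False using assms[OF that] by (simp add: weight_add)
  qed
  then show "lookup (perp (e_sym k) f) m = lookup 0 m"
    by (simp add: lookup_perp hall_def)
qed

lemma perp_e_eventually_0: "\<exists>N. \<forall>k \<ge> N. perp (e_sym k) f = 0"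
proof (intro exI allI impI)
  fix k assume k: "k \<ge> Suc (\<Sum>m \<in> keys f. weight m)"
  show "perp (e_sym k) f = 0"
  proof (rule perp_e_eq_0)
    fix m assume "m \<in> keys f"
    then show "weight m < k" using k member_le_sum[of m "keys f" weight] by simp
  qed
qed

lemma finite_phi_support:
  "finite {k::nat. (if j \<le> int k
     then scale ((-1) ^ k) (fps_nth Q_series (nat (int k - j)) * perp (e_sym k) f) else 0) \<noteq> 0}"
proof -
  obtain N where "\<forall>k \<ge> N. perp (e_sym k) f = 0" using perp_e_eventually_0 by blast
  then show ?thesis by (auto intro!: finite_subset[of _ "{..<N}"] simp: not_less[symmetric] split: if_splits)
qed

lemma phi_eventually_0: "\<exists>N. \<forall>j \<ge> N. phi j f = 0"
proof -
  obtain N where N: "\<forall>k \<ge> N. perp (e_sym k) f = 0" using perp_e_eventually_0 by blast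
  have "phi j f = 0" if "j \<ge> int N" for j
  proof -
    have "(if j \<le> int k then scale ((-1) ^ k) (fps_nth Q_series (nat (int k - j)) * perp (e_sym k) f)
        else 0) = 0" for k
      using N that by auto
    then show ?thesis unfolding phi_def by simp
  qed
  then show ?thesis by blast
qed

lemma finite_Gamma_support:
  assumes "rows_bounded_below A"
  shows "finite {j. scale (A i j) (phi j f) \<noteq> 0}"
proof -
  obtain M where M: "\<forall>j < M. A i j = 0" using assms by (auto simp: rows_bounded_below_def)
  obtain N where N: "\<forall>j \<ge> N. phi j f = 0" using phi_eventually_0 by blast
  have "{j. scale (A i j) (phi j f) \<noteq> 0} \<subseteq> {M..N}"
    using M N by (force simp: not_less[symmetric])
  then show ?thesis by (rule finite_subset) simp
qed

lemma tensor_0 [simp]: "tensor 0 g = 0" "tensor f 0 = 0"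
  by (simp_all add: tensor_def)

lemma finite_Omega_support:
  "finite {n::int. tensor_op (phi n) (\<lambda>g. scale ((-1) powi n) (phi (- n) g)) t \<noteq> 0}"
proof (rule finite_subset)
  let ?s = "\<lambda>m. Poly_Mapping.single m (1::complex)"
  have fin: "finite {n. phi n f \<noteq> 0 \<and> phi (- n) g \<noteq> 0}" for f g
  proof -
    obtain M where M: "\<forall>j \<ge> M. phi j f = 0" using phi_eventually_0 by blast
    obtain N where N: "\<forall>j \<ge> N. phi j g = 0" using phi_eventually_0 by blast
    have "{n. phi n f \<noteq> 0 \<and> phi (- n) g \<noteq> 0} \<subseteq> {- N..M}"
    proof
      fix n assume "n \<in> {n. phi n f \<noteq> 0 \<and> phi (- n) g \<noteq> 0}"
      then have "\<not> n \<ge> M" "\<not> - n \<ge> N" using M N by auto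
      then show "n \<in> {- N..M}" by simp
    qed
    then show ?thesis by (rule finite_subset) simp
  qed
  show "finite (\<Union>k \<in> keys t. {n. phi n (?s (fst k)) \<noteq> 0 \<and> phi (- n) (?s (snd k)) \<noteq> 0})"
    by (rule finite_UN_I[OF finite_keys]) (rule fin)
  show "{n. tensor_op (phi n) (\<lambda>g. scale ((-1) powi n) (phi (- n) g)) t \<noteq> 0} \<subseteq>
      (\<Union>k \<in> keys t. {n. phi n (?s (fst k)) \<noteq> 0 \<and> phi (- n) (?s (snd k)) \<noteq> 0})"
  proof
    fix n assume "n \<in> {n. tensor_op (phi n) (\<lambda>g. scale ((-1) powi n) (phi (- n) g)) t \<noteq> 0}"
    then obtain k where k: "k \<in> keys t" and nz: "scale (lookup t k) (tensor (phi n (?s (fst k)))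
        (scale ((-1) powi n) (phi (- n) (?s (snd k))))) \<noteq> 0"
      unfolding tensor_op_def by (auto elim: sum.not_neutral_contains_not_neutral)
    have "phi n (?s (fst k)) \<noteq> 0" "phi (- n) (?s (snd k)) \<noteq> 0"
      using nz by (metis scale_0 tensor_0(1)) (metis nz scale_0 tensor_0(2))
    with k show "n \<in> (\<Union>k \<in> keys t. {n. phi n (?s (fst k)) \<noteq> 0 \<and> phi (- n) (?s (snd k)) \<noteq> 0})"
      by blast
  qed
qed

end

theory Submission
  imports Defs
begin

text \<open>
  On \<open>\<Lambda>\<close> one has \<open>[p\<^sub>n\<^sup>\<bottom>, \<phi>\<^sub>j] = 2 \<phi>\<^bsub>j+n\<^esub>\<close> for odd \<open>n\<close>, \<open>[p\<^sub>n\<^sup>\<bottom>, \<phi>\<^sub>j] = 0\<close> for even \<open>n\<close>, and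
  \<open>[p\<^sub>n, \<phi>\<^sub>j] = \<phi>\<^bsub>j-n\<^esub>\<close>. These relations reduce the anticommutation relations on \<open>B_odd\<close> to their
  value at \<open>1\<close>, which is fixed by degree reasons and Newton's identity for \<open>Q\<^sub>n\<close>. For a combination
  \<open>X = (\<Sum>j. a\<^sub>j \<phi>\<^sub>j)\<close> with coefficients bounded below, \<open>X \<otimes> X\<close> then commutes with \<open>\<Omega>\<close>, so \<open>X\<close> preserves
  the bilinear identity. Conversely, if \<open>\<tau>\<close> is a non-constant solution, then \<open>\<phi>\<^sub>m \<tau> \<noteq> 0\<close> for some \<open>m > 0\<close>,
  the bilinear identity provides a \<open>Y\<close> with \<open>Y \<tau> = 0\<close> and \<open>\<tau> = Y \<phi>\<^sub>m \<tau>\<close>, and \<open>\<phi>\<^sub>m \<tau>\<close> is a solution of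
  smaller degree.
\<close>


section \<open>Linear operators and adjoints\<close>

lemma scale_conv_mult: "scale c f = Poly_Mapping.single 0 c * f" for f :: sym
  by (simp add: scale_def mult_map_scale_conv_mult)

lemma scale_add: "scale c (f + g) = scale c f + scale c g"
  by (rule poly_mapping_eqI) (simp add: lookup_add distrib_left)

lemma scale_add_left: "scale (c + d) f = scale c f + scale d f"
  by (rule poly_mapping_eqI) (simp add: lookup_add distrib_right)

lemma scale_scale [simp]: "scale c (scale d f) = scale (c * d) f"
  by (rule poly_mapping_eqI) simp

lemma scale_1 [simp]: "scale 1 f = f"
  by (rule poly_mapping_eqI) simp

lemma scale_minus_left: "scale (- c) f = - scale c f"
  by (rule poly_mapping_eqI) simp

lemma scale_diff: "scale c (f - g) = scale c f - scale c g"
  by (rule poly_mapping_eqI) (simp add: lookup_minus right_diff_distrib)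

lemma scale_single [simp]: "scale c (Poly_Mapping.single m d) = Poly_Mapping.single m (c * d)"
  by (rule poly_mapping_eqI) (simp add: lookup_single when_def)

lemma scale_sum: "scale c (sum f I) = (\<Sum>i\<in>I. scale c (f i))"
  by (induction I rule: infinite_finite_induct) (auto simp: scale_add)

lemma scale_sum_left: "scale (sum c I) f = (\<Sum>i\<in>I. scale (c i) f)"
  by (induction I rule: infinite_finite_induct) (auto simp: scale_add_left)

lemma scale_mult_left: "scale c f * g = scale c (f * g)" for f :: sym
  by (simp only: scale_conv_mult mult.assoc)

lemma scale_mult_right: "f * scale c g = scale c (f * g)" for f :: sym
  by (simp only: scale_conv_mult mult.left_commute)

lemma scale_of_nat: "scale (of_nat n) f = of_nat n * f" for f :: sym
  by (induction n) (auto simp: scale_add_left algebra_simps)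

lemma scale_eq_0_iff: "scale c f = 0 \<longleftrightarrow> c = 0 \<or> f = 0"
proof
  assume *: "scale c f = 0"
  show "c = 0 \<or> f = 0"
  proof (rule disjCI)
    assume "f \<noteq> 0"
    then obtain m where "lookup f m \<noteq> 0" by (metis poly_mapping_eqI lookup_zero)
    then show "c = 0" using arg_cong[OF *, of "\<lambda>g. lookup g m"] by simp
  qed
qed auto

definition linop :: "(('k \<Rightarrow>\<^sub>0 complex) \<Rightarrow> ('l \<Rightarrow>\<^sub>0 complex)) \<Rightarrow> bool"
  where "linop F \<longleftrightarrow> (\<forall>f g. F (f + g) = F f + F g) \<and> (\<forall>c f. F (scale c f) = scale c (F f))"

lemma linopI:
  "(\<And>f g. F (f + g) = F f + F g) \<Longrightarrow> (\<And>c f. F (scale c f) = scale c (F f)) \<Longrightarrow> linop F"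
  by (simp add: linop_def)

lemma linop_add: "linop F \<Longrightarrow> F (f + g) = F f + F g"
  and linop_scale: "linop F \<Longrightarrow> F (scale c f) = scale c (F f)"
  by (auto simp: linop_def)

lemma linop_0: "linop F \<Longrightarrow> F 0 = 0"
  using linop_scale[of F 0 0] by simp

lemma linop_minus: "linop F \<Longrightarrow> F (- f) = - F f"
  using linop_scale[of F "-1" f] by (simp add: scale_minus_left)

lemma linop_diff: "linop F \<Longrightarrow> F (f - g) = F f - F g"
  using linop_add[of F f "- g"] by (simp add: linop_minus)

lemma linop_sum: "linop F \<Longrightarrow> F (sum f I) = (\<Sum>i\<in>I. F (f i))"
  by (induction I rule: infinite_finite_induct) (auto simp: linop_add linop_0)

lemma linop_comp: "linop F \<Longrightarrow> linop G \<Longrightarrow> linop (\<lambda>f. F (G f))"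
  by (simp add: linop_def)

lemma linop_plus: "linop F \<Longrightarrow> linop G \<Longrightarrow> linop (\<lambda>f. F f + G f)"
  by (simp add: linop_def scale_add algebra_simps)

lemma linop_scaled: "linop F \<Longrightarrow> linop (\<lambda>f. scale c (F f))"
  by (simp add: linop_def scale_add mult.commute)

lemma linop_minus_op: "linop F \<Longrightarrow> linop G \<Longrightarrow> linop (\<lambda>f. F f - G f)"
  by (simp add: linop_def scale_diff algebra_simps)

lemma linop_id: "linop (\<lambda>f. f)"
  by (simp add: linop_def)

lemma linop_mult: "linop ((*) f)" for f :: sym
  by (simp add: linop_def scale_conv_mult algebra_simps)

lemma poly_expand: "f = (\<Sum>m \<in> keys f. scale (lookup f m) (Poly_Mapping.single m 1))"
  for f :: "'k \<Rightarrow>\<^sub>0 complex"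
  by (rule poly_mapping_eqI) (auto simp: lookup_sum lookup_single when_def in_keys_iff)

text \<open>Only the monomials of \<open>f\<close> are tested, so an identity valid on
  \<open>B_odd\<close> alone can still be checked monomial by monomial.\<close>

lemma linop_eqI:
  assumes "linop F" "linop G" "\<And>m. m \<in> keys f \<Longrightarrow> F (Poly_Mapping.single m 1) = G (Poly_Mapping.single m 1)"
  shows "F f = G f"
proof -
  have "F (\<Sum>m \<in> keys f. scale (lookup f m) (Poly_Mapping.single m 1)) =
      G (\<Sum>m \<in> keys f. scale (lookup f m) (Poly_Mapping.single m 1))"
    using assms by (simp add: linop_sum linop_scale del: scale_single)
  then show ?thesis using poly_expand[of f] by simp
qed

section \<open>Bilinearity of the scalar product and algebra of the adjoints\<close>

lemma hall_add_left: "hall (f + g) h = hall f h + hall g h"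
  using hall_add_right[of h f g] by (simp add: hall_commute)

lemma hall_scale_right: "hall f (scale c g) = c * hall f g"
  by (simp add: hall_def sum_distrib_left mult_ac)

lemma hall_scale_left: "hall (scale c f) g = c * hall f g"
  using hall_scale_right[of g c f] by (simp add: hall_commute)

lemma linop_perp: "linop (perp f)"
  by (intro linopI hall_eqI) (simp_all add: perp_adjoint hall_add_left hall_scale_left)

lemma perp_add_left: "perp (f + g) h = perp f h + perp g h"
  by (rule hall_eqI) (simp add: perp_adjoint hall_add_left hall_add_right distrib_right)

lemma perp_scale_left: "perp (scale c f) h = scale c (perp f h)"
  by (rule hall_eqI) (simp add: perp_adjoint hall_scale_left hall_scale_right scale_mult_left)

lemma perp_mult: "perp (f * g) h = perp g (perp f h)"
  by (rule hall_eqI) (simp add: perp_adjoint mult_ac)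

lemma perp_commute: "perp f (perp g h) = perp g (perp f h)"
  by (simp add: mult.commute flip: perp_mult)

lemma perp_1 [simp]: "perp 1 f = f"
  by (rule hall_eqI) (simp add: perp_adjoint)

section \<open>The derivations \<open>p\<^sub>n\<^sup>\<bottom>\<close>\<close>

text \<open>If variable \<open>i\<close> is absent from \<open>m\<close>, the truncated subtraction
  leaves \<open>m\<close> unchanged and the factor \<open>lookup m i = 0\<close> makes the value
  correct.\<close>

lemma perp_power_sum_single:
  "perp (power_sum (Suc i)) (Poly_Mapping.single m c) =
     Poly_Mapping.single (m - Poly_Mapping.single i 1) (of_nat (Suc i * lookup m i) * c)"
proof (rule poly_mapping_eqI)
  fix a
  let ?s = "Poly_Mapping.single i (1 :: nat)"
  show "lookup (perp (power_sum (Suc i)) (Poly_Mapping.single m c)) a = lookup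
      (Poly_Mapping.single (m - ?s) (of_nat (Suc i * lookup m i) * c)) a"
  proof (cases "m = ?s + a")
    case True
    then show ?thesis by (simp add: lookup_perp_power_sum lookup_add algebra_simps)
  next
    case False
    have "lookup m i = 0 \<or> m - ?s \<noteq> a"
    proof (rule ccontr)
      assume "\<not> (lookup m i = 0 \<or> m - ?s \<noteq> a)"
      then have "m = ?s + a"
        by (intro poly_mapping_eqI) (auto simp: lookup_add lookup_minus lookup_single when_def)
      then show False using False by simp
    qed
    then show ?thesis using False by (auto simp: lookup_perp_power_sum lookup_single when_def)
  qed
qed

text \<open>Both sides are linear in \<open>f\<close> and in \<open>g\<close>, so two monomials
  suffice; there the exponents of p_n add.\<close>

lemma perp_power_sum_mult:
  assumes "n > 0"
  shows "perp (power_sum n) (f * g) = perp (power_sum n) f * g + f * perp (power_sum n) g"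
proof -
  obtain i where n: "n = Suc i" using assms by (cases n) auto
  let ?D = "perp (power_sum n)"
  let ?s = "\<lambda>m. Poly_Mapping.single m (1 :: complex)"
  have singles: "?D (?s a * ?s b) = ?D (?s a) * ?s b + ?s a * ?D (?s b)" for a b :: monom
  proof -
    \<comment> \<open>Truncated subtraction passes through the sum only where the exponent is
      positive; otherwise the term has coefficient 0.\<close>
    have "a - Poly_Mapping.single i 1 + b = a + b - Poly_Mapping.single i 1" if "lookup a i \<noteq> 0"
      using that by (auto simp: poly_mapping_eq_iff fun_eq_iff lookup_add lookup_minus lookup_single when_def)
    moreover have "a + (b - Poly_Mapping.single i 1) = a + b - Poly_Mapping.single i 1"
      if "lookup b i \<noteq> 0"
      using that by (auto simp: poly_mapping_eq_iff fun_eq_iff lookup_add lookup_minus lookup_single when_def)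
    ultimately show ?thesis
      unfolding n perp_power_sum_single mult_single
      by (cases "lookup a i = 0"; cases "lookup b i = 0")
        (simp_all add: lookup_add algebra_simps flip: single_add)
  qed
  have right: "linop (\<lambda>g. f * g)" "linop (\<lambda>g. g * f)" for f :: sym
  proof -
    have "(\<lambda>g. g * f) = (*) f" by (simp add: fun_eq_iff mult.commute)
    then show "linop (\<lambda>g. f * g)" "linop (\<lambda>g. g * f)" using linop_mult[of f] by simp_all
  qed
  note D = linop_comp[OF linop_perp[of "power_sum n"]]
  have left: "?D (?s a * g) = ?D (?s a) * g + ?s a * ?D g" for a g
    by (rule linop_eqI[where f = g, OF D[OF right(1)] linop_plus[OF right(1)
        linop_comp[OF right(1) linop_perp]] singles])
  show ?thesis
    by (rule linop_eqI[where f = f, OF D[OF right(2)] linop_plus[OF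
        linop_comp[OF right(2) linop_perp] right(2)] left])
qed

lemma perp_power_sum_1: "n > 0 \<Longrightarrow> perp (power_sum n) 1 = 0"
  using perp_power_sum_mult[of n 1 1] by simp

lemma perp_power_sum_power_sum:
  assumes "n > 0" "m > 0"
  shows "perp (power_sum n) (power_sum m) = (if m = n then scale (of_nat n) 1 else 0)"
proof -
  obtain i where n: "n = Suc i" using assms by (cases n) auto
  obtain j where m: "m = Suc j" using assms by (cases m) auto
  have "perp (power_sum n) (power_sum m) =
      Poly_Mapping.single (Poly_Mapping.single j 1 - Poly_Mapping.single i 1)
        (of_nat (Suc i * lookup (Poly_Mapping.single j 1) i) * 1)"
    unfolding n m perp_power_sum_single[symmetric] power_sum_def[of "Suc j"] by simp
  moreover have "Poly_Mapping.single 0 (of_nat (Suc i)) = scale (of_nat (Suc i)) (1 :: sym)"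
    by (simp only: single_of_nat scale_of_nat mult_1_right)
  ultimately show ?thesis by (cases "j = i") (simp_all add: n m lookup_single when_def del: of_nat_Suc)
qed


section \<open>Derivations of exponential series\<close>

definition coeffwise :: "(nat \<Rightarrow> sym \<Rightarrow> sym) \<Rightarrow> sym fps \<Rightarrow> sym fps"
  where "coeffwise d F = Abs_fps (\<lambda>n. d n (fps_nth F n))"

text \<open>The operator may depend on the degree, which covers both
  \<open>perp (power_sum n)\<close> on every coefficient and multiplication of the n-th coefficient
  by n, that is u d/du.\<close>

locale series_derivation =
  fixes d :: "nat \<Rightarrow> sym \<Rightarrow> sym"
  assumes lin: "linop (d n)"
    and leibniz: "d (i + j) (f * g) = d i f * g + f * d j g"
begin

lemma coeffwise_mult: "coeffwise d (F * G) = coeffwise d F * G + F * coeffwise d G"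
proof (rule fps_ext)
  fix n
  have "d n (fps_nth F i * fps_nth G (n - i)) =
      d i (fps_nth F i) * fps_nth G (n - i) + fps_nth F i * d (n - i) (fps_nth G (n - i))"
    if "i \<le> n" for i
    using leibniz[of i "n - i"] that by simp
  then show "fps_nth (coeffwise d (F * G)) n = fps_nth (coeffwise d F * G + F * coeffwise d G) n"
    by (simp add: coeffwise_def fps_mult_nth linop_sum[OF lin] sum.distrib)
qed

lemma coeffwise_power: "coeffwise d (F ^ k) = of_nat k * F ^ (k - 1) * coeffwise d F"
proof (induction k)
  case 0
  show ?case using coeffwise_mult[of 1 1] by simp
next
  case (Suc k)
  then show ?case by (cases k) (simp_all add: coeffwise_mult algebra_simps)
qed

text \<open>Chain rule, obtained termwise. As \<open>F\<close> has no constant term, powers above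
  \<open>n\<close> do not reach degree \<open>n\<close>, so all sums can be cut at the same
  index.\<close>

lemma coeffwise_exp:
  assumes F0: "fps_nth F 0 = 0"
  shows "coeffwise d (exp_series F) = coeffwise d F * exp_series F"
proof (rule fps_ext)
  fix n
  let ?c = "\<lambda>i. 1 / fact i :: complex"
  have nth_exp: "fps_nth (exp_series F) m = (\<Sum>i=0..k. scale (?c i) (fps_nth (F ^ i) m))"
    if "m \<le> k" for m k
  proof -
    have "fps_nth (exp_series F) m = (\<Sum>i=0..m. scale (?c i) (fps_nth (F ^ i) m))"
      by (simp add: exp_series_def fps_compose_nth scale_conv_mult)
    also have "\<dots> = (\<Sum>i=0..k. scale (?c i) (fps_nth (F ^ i) m))"
      using that F0 by (intro sum.mono_neutral_left) (auto simp: startsby_zero_power_prefix)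
    finally show ?thesis .
  qed
  have step: "scale (?c (Suc i)) (fps_nth (coeffwise d (F ^ Suc i)) n) =
      scale (?c i) (fps_nth (coeffwise d F * F ^ i) n)" for i
  proof -
    have "fps_nth (coeffwise d (F ^ Suc i)) n = scale (of_nat (Suc i)) (fps_nth (coeffwise d F * F ^ i) n)"
      by (simp only: coeffwise_power scale_of_nat fps_of_nat[symmetric] diff_Suc_1 mult.assoc
          fps_mult_left_const_nth mult.commute[of "F ^ i"])
    moreover have "?c (Suc i) * of_nat (Suc i) = ?c i"
      by (simp add: field_simps del: of_nat_Suc)
    ultimately show ?thesis by simp
  qed
  have d0: "fps_nth (coeffwise d F) 0 = 0" by (simp add: coeffwise_def F0 linop_0[OF lin])
  \<comment> \<open>The index shift leaves only the powers below \<open>n\<close>; this zero term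
    completes the sum up to \<open>n\<close>.\<close>
  have top: "fps_nth (coeffwise d F * F ^ n) n = 0"
  proof -
    have "fps_nth (coeffwise d F) i * fps_nth (F ^ n) (n - i) = 0" if "i \<le> n" for i
      using that F0 d0 startsby_zero_power_prefix[of F n] by (cases "i = 0") auto
    then show ?thesis unfolding fps_mult_nth by (intro sum.neutral) simp
  qed
  have "fps_nth (coeffwise d (exp_series F)) n = (\<Sum>i=0..n. scale (?c i) (fps_nth (coeffwise d (F ^ i)) n))"
    by (simp add: coeffwise_def nth_exp[of n n] linop_sum[OF lin] linop_scale[OF lin])
  also have "\<dots> = (\<Sum>i=0..<n. scale (?c i) (fps_nth (coeffwise d F * F ^ i) n))"
    using coeffwise_power[of F 0]
    by (simp add: atLeast0AtMost atLeast0LessThan sum.atMost_shift step del: power_Suc fact_Suc)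
  also have "\<dots> = (\<Sum>i=0..n. scale (?c i) (fps_nth (coeffwise d F * F ^ i) n))"
    using top by (simp add: atLeast0AtMost atLeast0LessThan flip: lessThan_Suc_atMost)
  also have "\<dots> = (\<Sum>i=0..n. \<Sum>m=0..n. fps_nth (coeffwise d F) m * scale (?c i) (fps_nth (F ^ i) (n - m)))"
    by (simp add: fps_mult_nth scale_sum scale_mult_right)
  also have "\<dots> = (\<Sum>m=0..n. \<Sum>i=0..n. fps_nth (coeffwise d F) m * scale (?c i) (fps_nth (F ^ i) (n - m)))"
    by (rule sum.swap)
  also have "\<dots> = fps_nth (coeffwise d F * exp_series F) n"
    by (simp add: fps_mult_nth nth_exp[of _ n] sum_distrib_left)
  finally show "fps_nth (coeffwise d (exp_series F)) n = fps_nth (coeffwise d F * exp_series F) n" .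
qed

end

lemma scale_2: "scale 2 f = 2 * f" for f :: sym
  using scale_of_nat[of 2 f] by simp


section \<open>The series \<open>E\<close>, \<open>H\<close> and \<open>Q\<close>\<close>

definition power_sum_series :: "(nat \<Rightarrow> complex) \<Rightarrow> sym fps"
  where "power_sum_series c = Abs_fps (\<lambda>n. if n = 0 then 0 else scale (c n) (power_sum n))"

lemma power_sum_series_0 [simp]: "fps_nth (power_sum_series c) 0 = 0"
  by (simp add: power_sum_series_def)

lemma E_series_alt: "E_series = exp_series (power_sum_series (\<lambda>n. (-1) ^ (n - 1) / of_nat n))"
  and H_series_alt: "H_series = exp_series (power_sum_series (\<lambda>n. 1 / of_nat n))"
  by (simp_all only: E_series_def H_series_def power_sum_series_def)

lemma exp_series_nth_0 [simp]: "fps_nth (exp_series F) 0 = 1"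
  by (simp add: exp_series_def)

lemma Q_nth_0 [simp]: "fps_nth Q_series 0 = 1"
  by (simp add: Q_series_def E_series_def H_series_def)

lemma e_0 [simp]: "e_sym 0 = 1"
  by (simp add: E_series_def)

lemma perp_derivation: "n > 0 \<Longrightarrow> series_derivation (\<lambda>i. perp (power_sum n))"
  by unfold_locales (auto simp: linop_perp perp_power_sum_mult)

lemma euler_derivation: "series_derivation (\<lambda>n. scale (of_nat n))"
  by unfold_locales
    (auto intro!: linopI simp: scale_add scale_add_left scale_mult_left scale_mult_right mult.commute)

text \<open>Only the term of p_n in the exponent survives, so the logarithmic derivative of the
  series is n c_n u^n.\<close>

lemma coeffwise_perp_exp:
  assumes "n > 0"
  shows "coeffwise (\<lambda>i. perp (power_sum n)) (exp_series (power_sum_series c)) =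
    fps_const (scale (c n * of_nat n) 1) * fps_X ^ n * exp_series (power_sum_series c)"
proof -
  have "coeffwise (\<lambda>i. perp (power_sum n)) (power_sum_series c) =
      fps_const (scale (c n * of_nat n) 1) * fps_X ^ n"
    by (rule fps_ext) (use assms in \<open>auto simp: coeffwise_def power_sum_series_def
      linop_scale[OF linop_perp] linop_0[OF linop_perp] perp_power_sum_power_sum fps_X_power_nth\<close>)
  then show ?thesis
    using series_derivation.coeffwise_exp[OF perp_derivation[OF assms] power_sum_series_0] by simp
qed

lemma perp_e:
  assumes "n > 0"
  shows "perp (power_sum n) (e_sym k) = (if n \<le> k then scale ((-1) ^ (n - 1)) (e_sym (k - n)) else 0)"
proof -
  have "perp (power_sum n) (e_sym k) = fps_nth (coeffwise (\<lambda>i. perp (power_sum n)) E_series) k"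
    by (simp add: coeffwise_def)
  then show ?thesis
    using assms by (simp add: E_series_alt coeffwise_perp_exp mult.assoc fps_X_power_mult_nth scale_mult_left)
qed

text \<open>The logarithmic derivatives of E and H add up to ((-1)^(n-1) + 1) u^n, which is 2 u^n
  for odd n and 0 for even n.\<close>

lemma perp_Q:
  assumes "n > 0"
  shows "perp (power_sum n) (fps_nth Q_series k) =
    (if odd n \<and> n \<le> k then scale 2 (fps_nth Q_series (k - n)) else 0)"
proof -
  let ?C = "coeffwise (\<lambda>i. perp (power_sum n))"
  have "perp (power_sum n) (fps_nth Q_series k) = fps_nth (?C Q_series) k"
    by (simp add: coeffwise_def)
  also have "?C Q_series = fps_const (scale ((-1) ^ (n - 1) + 1) 1) * (fps_X ^ n * Q_series)"
    unfolding Q_series_def series_derivation.coeffwise_mult[OF perp_derivation[OF assms]]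
      E_series_alt H_series_alt coeffwise_perp_exp[OF assms]
    using assms by (simp add: scale_add_left distrib_right flip: fps_const_add)
  finally show ?thesis using assms by (auto simp: fps_X_power_mult_nth scale_mult_left)
qed

lemma coeffwise_euler_exp:
  "coeffwise (\<lambda>n. scale (of_nat n)) (exp_series (power_sum_series c)) =
    power_sum_series (\<lambda>n. of_nat n * c n) * exp_series (power_sum_series c)"
proof -
  have "coeffwise (\<lambda>n. scale (of_nat n)) (power_sum_series c) = power_sum_series (\<lambda>n. of_nat n * c n)"
    by (rule fps_ext) (simp add: coeffwise_def power_sum_series_def)
  then show ?thesis using series_derivation.coeffwise_exp[OF euler_derivation power_sum_series_0] by simp
qed

text \<open>Coefficients of u d/du log E(u). In \<open>vacuum_unique\<close> this recovers p_k^perp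
  from the operators e_k^perp.\<close>

lemma newton_e:
  "scale (of_nat k) (e_sym k) = (\<Sum>n=1..k. scale ((-1) ^ (n - 1)) (power_sum n * e_sym (k - n)))"
proof -
  have "scale (of_nat k) (e_sym k) = fps_nth (coeffwise (\<lambda>n. scale (of_nat n)) E_series) k"
    by (simp add: coeffwise_def)
  also have "\<dots> = (\<Sum>n=0..k. fps_nth (power_sum_series (\<lambda>n. of_nat n * ((-1) ^ (n - 1) / of_nat n))) n
      * e_sym (k - n))"
    by (simp only: E_series_alt coeffwise_euler_exp fps_mult_nth)
  also have "\<dots> = (\<Sum>n=1..k. scale ((-1) ^ (n - 1)) (power_sum n * e_sym (k - n)))"
    by (intro sum.mono_neutral_cong_right) (auto simp: power_sum_series_def scale_mult_left)
  finally show ?thesis .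
qed

text \<open>In u d/du log (E H) the even power sums cancel and the odd ones double.\<close>

lemma newton_Q:
  "scale (of_nat k) (fps_nth Q_series k) =
    (\<Sum>n=1..k. if odd n then scale 2 (power_sum n * fps_nth Q_series (k - n)) else 0)"
proof -
  let ?C = "coeffwise (\<lambda>n. scale (of_nat n))"
  let ?P = "\<lambda>n. of_nat n * ((-1) ^ (n - 1) / of_nat n) :: complex"
    and ?R = "\<lambda>n. of_nat n * (1 / of_nat n) :: complex"
  have "scale (of_nat k) (fps_nth Q_series k) = fps_nth (?C Q_series) k"
    by (simp add: coeffwise_def)
  also have "?C Q_series = power_sum_series ?P * E_series * H_series + E_series * (power_sum_series ?R * H_series)"
    unfolding Q_series_def series_derivation.coeffwise_mult[OF euler_derivation]
    by (simp only: E_series_alt H_series_alt coeffwise_euler_exp)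
  also have "\<dots> = (power_sum_series ?P + power_sum_series ?R) * Q_series"
    unfolding Q_series_def by (simp add: algebra_simps)
  also have "fps_nth \<dots> k = (\<Sum>n=1..k. if odd n then scale 2 (power_sum n * fps_nth Q_series (k - n)) else 0)"
    unfolding fps_mult_nth
    by (intro sum.mono_neutral_cong_right)
      (auto simp: power_sum_series_def scale_mult_left scale_minus_left scale_2)
  finally show ?thesis .
qed

text \<open>Extending \<open>Q\<^sub>n\<close> by zero to negative \<open>n\<close> removes the case distinction in \<^const>\<open>phi\<close>.\<close>

definition Qz :: "int \<Rightarrow> sym"
  where "Qz n = (if n < 0 then 0 else fps_nth Q_series (nat n))"

lemma Qz_of_nat [simp]: "Qz (int n) = fps_nth Q_series n"
  by (simp add: Qz_def)

lemma Qz_0 [simp]: "Qz 0 = 1"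
  by (simp add: Qz_def)

lemma Qz_neg [simp]: "n < 0 \<Longrightarrow> Qz n = 0"
  by (simp add: Qz_def)

lemma perp_Qz:
  assumes "n > 0"
  shows "perp (power_sum n) (Qz i) = (if odd n then scale 2 (Qz (i - int n)) else 0)"
proof (cases "i < 0")
  case False
  then obtain k where "i = int k" by (metis nonneg_int_cases not_less)
  then show ?thesis using assms by (auto simp: perp_Q Qz_def nat_diff_distrib')
qed (simp add: linop_0[OF linop_perp])

lemma weight_Qz: "m \<in> keys (Qz i) \<Longrightarrow> int (weight m) = i"
  using graded_mult[OF graded_E graded_H]
  by (auto simp: Qz_def graded_def Q_series_def split: if_splits)


section \<open>Commutation relations of the operators \<open>\<phi>\<^sub>j\<close>\<close>

text \<open>Any \<open>N\<close> beyond the last non-zero \<open>perp (e_sym k) f\<close> is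
  allowed, so several elements can share one range of summation.\<close>

lemma phi_eq:
  assumes "\<And>k. k \<ge> N \<Longrightarrow> perp (e_sym k) f = 0"
  shows "phi j f = (\<Sum>k<N. scale ((-1) ^ k) (Qz (int k - j) * perp (e_sym k) f))"
proof -
  have "phi j f = Sum_any (\<lambda>k. scale ((-1) ^ k) (Qz (int k - j) * perp (e_sym k) f))"
    unfolding phi_def by (rule Sum_any.cong) (auto simp: Qz_def)
  also have "\<dots> = (\<Sum>k<N. scale ((-1) ^ k) (Qz (int k - j) * perp (e_sym k) f))"
    by (rule Sum_any.expand_superset) (use assms in \<open>force simp: not_less[symmetric]\<close>)+
  finally show ?thesis .
qed

lemma perp_e_bound2:
  obtains N where "\<And>k. k \<ge> N \<Longrightarrow> perp (e_sym k) f = 0" "\<And>k. k \<ge> N \<Longrightarrow> perp (e_sym k) g = 0"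
proof -
  obtain M where M: "\<forall>k \<ge> M. perp (e_sym k) f = 0" using perp_e_eventually_0 by blast
  obtain N where N: "\<forall>k \<ge> N. perp (e_sym k) g = 0" using perp_e_eventually_0 by blast
  show ?thesis by (rule that[of "max M N"]) (use M N in auto)
qed

lemma linop_phi: "linop (phi j)"
proof (rule linopI)
  fix f g
  obtain N where N: "\<And>k. k \<ge> N \<Longrightarrow> perp (e_sym k) f = 0" "\<And>k. k \<ge> N \<Longrightarrow> perp (e_sym k) g = 0"
    using perp_e_bound2 by blast
  then have "perp (e_sym k) (f + g) = 0" if "k \<ge> N" for k
    using that by (simp add: linop_add[OF linop_perp])
  then show "phi j (f + g) = phi j f + phi j g"
    by (simp add: phi_eq[of N] N linop_add[OF linop_perp] scale_add distrib_left sum.distrib)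
next
  fix c f
  obtain N where N: "\<And>k. k \<ge> N \<Longrightarrow> perp (e_sym k) f = 0"
    using perp_e_eventually_0 by blast
  then have "perp (e_sym k) (scale c f) = 0" if "k \<ge> N" for k
    using that by (simp add: linop_scale[OF linop_perp])
  then show "phi j (scale c f) = scale c (phi j f)"
    by (simp add: phi_eq[of N] N linop_scale[OF linop_perp] scale_sum scale_mult_right mult.commute)
qed

lemma weight_perp_e:
  assumes "m \<in> keys (perp (e_sym k) f)"
  obtains b where "b \<in> keys f" "weight b = weight m + k"
proof -
  have "hall f (e_sym k * Poly_Mapping.single m 1) \<noteq> 0"
    using assms by (auto simp: in_keys_iff lookup_perp)
  then obtain b where b: "b \<in> keys f" "lookup (e_sym k * Poly_Mapping.single m 1) b \<noteq> 0"
    unfolding hall_def by (metis (no_types, lifting) mult_zero_right sum.neutral)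
  then have "b \<in> keys (e_sym k * Poly_Mapping.single m 1)" by (simp add: in_keys_iff)
  then obtain a where "a \<in> keys (e_sym k)" "b = a + m" using keys_mult by fastforce
  moreover from this have "weight a = k" using graded_E by (auto simp: graded_def)
  ultimately show ?thesis using that b(1) by (simp add: weight_add)
qed

text \<open>\<open>Qz (int k - j)\<close> adds weight k - j and e_k^perp removes k, so
  \<open>phi j\<close> lowers the weight by j. The claim concerns single monomials because
  \<open>f\<close> need not be homogeneous.\<close>

lemma weight_phi:
  assumes "m \<in> keys (phi j f)"
  obtains b where "b \<in> keys f" "int (weight b) = int (weight m) + j"
proof -
  obtain N where N: "\<And>k. k \<ge> N \<Longrightarrow> perp (e_sym k) f = 0" using perp_e_eventually_0 by blast
  have "m \<in> keys (\<Sum>k<N. scale ((-1) ^ k) (Qz (int k - j) * perp (e_sym k) f))"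
    using assms by (subst phi_eq[OF N, symmetric]) simp_all
  then obtain k where "m \<in> keys (scale ((-1) ^ k) (Qz (int k - j) * perp (e_sym k) f))"
    by (blast dest: subsetD[OF keys_sum])
  then have "m \<in> keys (Qz (int k - j) * perp (e_sym k) f)" by (rule subsetD[OF keys_scale])
  then obtain a b where ab: "a \<in> keys (Qz (int k - j))" "b \<in> keys (perp (e_sym k) f)" "m = a + b"
    using keys_mult by blast
  obtain b' where "b' \<in> keys f" "weight b' = weight b + k" using weight_perp_e[OF ab(2)] .
  then show ?thesis using that[of b'] weight_Qz[OF ab(1)] ab(3) by (simp add: weight_add)
qed

text \<open>Across the scalar product, multiplication by p_n is the derivation p_n^perp; the product
  rule there produces the extra term with p_n^perp e_k.\<close>

lemma perp_e_power_sum: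
  assumes "n > 0"
  shows "perp (e_sym k) (power_sum n * f) = power_sum n * perp (e_sym k) f +
    (if n \<le> k then scale ((-1) ^ (n - 1)) (perp (e_sym (k - n)) f) else 0)"
proof (rule hall_eqI)
  fix h
  have "hall (perp (e_sym k) (power_sum n * f)) h = hall (e_sym k * h) (power_sum n * f)"
    by (simp only: perp_adjoint hall_commute[of "e_sym k * h"])
  also have "\<dots> = hall (perp (power_sum n) (e_sym k) * h + e_sym k * perp (power_sum n) h) f"
    by (simp add: perp_power_sum_mult[OF assms] flip: perp_adjoint)
  also have "\<dots> = hall (perp (power_sum n) (e_sym k) * h) f + hall (perp (e_sym k) f) (perp (power_sum n) h)"
    by (simp only: hall_add_left hall_add_right perp_adjoint hall_commute[of _ f])
  also have "hall (perp (e_sym k) f) (perp (power_sum n) h) = hall (power_sum n * perp (e_sym k) f) h"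
    by (metis hall_commute perp_adjoint)
  also have "hall (perp (power_sum n) (e_sym k) * h) f =
      hall (if n \<le> k then scale ((-1) ^ (n - 1)) (perp (e_sym (k - n)) f) else 0) h"
    by (simp add: perp_e[OF assms] scale_mult_left hall_scale_left hall_scale_right perp_adjoint hall_commute[of _ f])
      (simp add: hall_def)
  finally show "hall (perp (e_sym k) (power_sum n * f)) h = hall (power_sum n * perp (e_sym k) f +
    (if n \<le> k then scale ((-1) ^ (n - 1)) (perp (e_sym (k - n)) f) else 0)) h"
    by (simp add: hall_add_left)
qed

text \<open>The extra terms of \<open>perp_e_power_sum\<close> carry the sign -(-1)^(k-n); shifting
  k by n collects them into \<open>- phi (j - int n) f\<close>.\<close>

lemma phi_power_sum_mult:
  assumes "n > 0"
  shows "phi j (power_sum n * f) = power_sum n * phi j f - phi (j - int n) f"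
proof -
  obtain N where N: "\<And>k. k \<ge> N \<Longrightarrow> perp (e_sym k) f = 0" using perp_e_eventually_0 by blast
  let ?t = "\<lambda>k. scale ((-1) ^ k) (Qz (int k - (j - int n)) * perp (e_sym k) f)"
  have "perp (e_sym k) (power_sum n * f) = 0" if "k \<ge> N + n" for k
    using that by (simp add: perp_e_power_sum[OF assms] N)
  then have "phi j (power_sum n * f) =
      (\<Sum>k<N+n. scale ((-1) ^ k) (Qz (int k - j) * perp (e_sym k) (power_sum n * f)))"
    by (rule phi_eq)
  also have "\<dots> = (\<Sum>k<N+n. power_sum n * scale ((-1) ^ k) (Qz (int k - j) * perp (e_sym k) f)
      + (if n \<le> k then - ?t (k - n) else 0))"
  proof (rule sum.cong)
    fix k
    have "(-1) ^ k * (-1) ^ (n - 1) = - ((-1) ^ (k - n) :: complex)" if nk: "n \<le> k"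
    proof -
      obtain i where "n = Suc i" using assms by (cases n) auto
      moreover obtain l where "k = n + l" using nk le_Suc_ex by blast
      ultimately show ?thesis by (simp add: power_add flip: power_mult_distrib)
    qed
    moreover have "Qz (int k - j) = Qz (int (k - n) - (j - int n))" if "n \<le> k"
      using that by (simp add: of_nat_diff algebra_simps)
    ultimately show "scale ((-1) ^ k) (Qz (int k - j) * perp (e_sym k) (power_sum n * f)) =
        power_sum n * scale ((-1) ^ k) (Qz (int k - j) * perp (e_sym k) f)
        + (if n \<le> k then - ?t (k - n) else 0)"
      by (simp add: perp_e_power_sum[OF assms] distrib_left scale_add scale_mult_right
        scale_minus_left mult.left_commute)
  qed simp
  also have "\<dots> = power_sum n * phi j f + (\<Sum>k<N+n. if n \<le> k then - ?t (k - n) else 0)"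
    by (subst phi_eq[of "N + n"]) (simp_all add: N sum.distrib sum_distrib_left)
  also have "(\<Sum>k<N+n. if n \<le> k then - ?t (k - n) else 0) = (\<Sum>k\<in>{n..<N+n}. - ?t (k - n))"
    by (rule sum.mono_neutral_cong_right) auto
  also have "\<dots> = (\<Sum>k<N. - ?t k)"
    using sum.shift_bounds_nat_ivl[of "\<lambda>k. - ?t (k - n)" 0 n N] by (simp add: atLeast0LessThan)
  also have "\<dots> = - phi (j - int n) f" by (subst phi_eq[OF N]) (simp_all add: sum_negf)
  finally show ?thesis by simp
qed

text \<open>The derivation p_n^perp commutes with every e_k^perp, so the bracket comes from
  \<open>Qz\<close> alone.\<close>

lemma perp_power_sum_phi:
  assumes "n > 0"
  shows "perp (power_sum n) (phi j f) =
    phi j (perp (power_sum n) f) + (if odd n then scale 2 (phi (j + int n) f) else 0)"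
proof -
  obtain N where N: "\<And>k. k \<ge> N \<Longrightarrow> perp (e_sym k) f = 0" using perp_e_eventually_0 by blast
  then have N': "perp (e_sym k) (perp (power_sum n) f) = 0" if "k \<ge> N" for k
    using that by (simp add: perp_commute[of "e_sym k"] linop_0[OF linop_perp])
  have Q: "perp (power_sum n) (Qz (int k - j)) = (if odd n then scale 2 (Qz (int k - (j + int n))) else 0)" for k
    by (simp add: perp_Qz[OF assms] diff_diff_eq)
  have "perp (power_sum n) (phi j f) = (\<Sum>k<N. scale ((-1) ^ k)
      ((if odd n then scale 2 (Qz (int k - (j + int n))) else 0) * perp (e_sym k) f
       + Qz (int k - j) * perp (e_sym k) (perp (power_sum n) f)))"
    by (simp add: phi_eq[OF N] linop_sum[OF linop_perp] linop_scale[OF linop_perp]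
      perp_power_sum_mult[OF assms] Q perp_commute[of "power_sum n"])
  then show ?thesis
    by (auto simp: phi_eq[OF N'] phi_eq[OF N] scale_add sum.distrib scale_sum scale_mult_left
      mult.commute[of _ "2 :: complex"])
qed

lemma phi_1: "phi j 1 = Qz (- j)"
proof -
  have "perp (e_sym k) 1 = 0" if "k \<ge> 1" for k
    by (rule perp_e_eq_0) (use that in \<open>auto simp: weight_def\<close>)
  then show ?thesis by (subst phi_eq[of 1]) auto
qed


section \<open>The subring \<open>B_odd\<close> and the anticommutation relations\<close>

text \<open>As a common kernel of derivations, \<open>B_odd\<close> is visibly closed under linear
  combinations, and under \<open>phi j\<close> because the bracket vanishes for even n.\<close>

lemma B_odd_iff: "f \<in> B_odd \<longleftrightarrow> (\<forall>n>0. even n \<longrightarrow> perp (power_sum n) f = 0)"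
proof (intro iffI allI impI)
  fix n assume f: "f \<in> B_odd" and n: "n > (0 :: nat)" "even n"
  then obtain i where i: "n = Suc i" by (cases n) auto
  have "lookup f (Poly_Mapping.single i 1 + m) = 0" for m
  proof (rule ccontr)
    assume "lookup f (Poly_Mapping.single i 1 + m) \<noteq> 0"
    moreover have "i \<in> keys (Poly_Mapping.single i 1 + m)" by (simp add: in_keys_iff lookup_add)
    ultimately have "odd (Suc i)" using f by (auto simp: B_odd_def in_keys_iff)
    then show False using n i by simp
  qed
  then show "perp (power_sum n) f = 0"
    unfolding i by (intro poly_mapping_eqI) (simp add: lookup_perp_power_sum)
next
  assume *: "\<forall>n>0. even n \<longrightarrow> perp (power_sum n) f = 0"
  show "f \<in> B_odd" unfolding B_odd_def
  proof safe
    fix m i assume m: "m \<in> keys f" "i \<in> keys m" and "even (Suc i)"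
    then have "perp (power_sum (Suc i)) f = 0" using * by blast
    then have "lookup (perp (power_sum (Suc i)) f) (m - Poly_Mapping.single i 1) = 0" by simp
    moreover have "Poly_Mapping.single i 1 + (m - Poly_Mapping.single i 1) = m"
      using m(2) by (intro poly_mapping_eqI)
        (auto simp: lookup_add lookup_minus lookup_single when_def in_keys_iff)
    ultimately have "lookup f m = 0"
      by (auto simp: lookup_perp_power_sum simp del: of_nat_Suc)
    then show False using m(1) by (simp add: in_keys_iff)
  qed
qed

lemma B_odd_0 [simp]: "0 \<in> B_odd"
  by (simp add: B_odd_def)

lemma B_odd_1 [simp]: "1 \<in> B_odd"
  by (simp add: B_odd_def)

lemma B_odd_add: "f \<in> B_odd \<Longrightarrow> g \<in> B_odd \<Longrightarrow> f + g \<in> B_odd"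
  by (simp add: B_odd_iff linop_add[OF linop_perp])

lemma B_odd_scale: "f \<in> B_odd \<Longrightarrow> scale c f \<in> B_odd"
  by (simp add: B_odd_iff linop_scale[OF linop_perp])

lemma B_odd_sum: "(\<And>i. i \<in> I \<Longrightarrow> f i \<in> B_odd) \<Longrightarrow> sum f I \<in> B_odd"
  by (induction I rule: infinite_finite_induct) (auto intro: B_odd_add)

lemma B_odd_phi: "f \<in> B_odd \<Longrightarrow> phi j f \<in> B_odd"
  by (simp add: B_odd_iff perp_power_sum_phi linop_0[OF linop_phi])

lemma constant_if_perp_0:
  assumes "\<And>n. n > 0 \<Longrightarrow> perp (power_sum n) f = 0"
  shows "f = scale (lookup f 0) 1"
proof (rule poly_mapping_eqI)
  fix m
  show "lookup f m = lookup (scale (lookup f 0) 1) m"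
  proof (cases "m = 0")
    case True
    then show ?thesis by (simp add: lookup_one)
  next
    case False
    then obtain i where i: "lookup m i \<noteq> 0" by (metis poly_mapping_eqI lookup_zero)
    have "lookup (perp (power_sum (Suc i)) f) (m - Poly_Mapping.single i 1) = 0"
      using assms by simp
    moreover have "Poly_Mapping.single i 1 + (m - Poly_Mapping.single i 1) = m"
      using i by (intro poly_mapping_eqI)
        (auto simp: lookup_add lookup_minus lookup_single when_def in_keys_iff)
    ultimately have "lookup f m = 0"
      by (auto simp: lookup_perp_power_sum simp del: of_nat_Suc)
    then show ?thesis using False by (simp add: lookup_one)
  qed
qed

section \<open>Values of the operators on the vacuum\<close>

lemma minus_one_powi: "(-1 :: complex) powi n = (if even n then 1 else -1)"
  by (simp add: power_int_minus_left)

lemma phi_0_1 [simp]: "phi 0 1 = 1"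
  by (simp add: phi_1)

text \<open>The sum arising in \<open>phi_Q\<close>; the value 1 at \<open>n = k\<close> stands for
  \<open>phi 0 1 = 1\<close>. Passing from k to k + 2 shifts the terms by two, and only
  \<open>n = 1\<close> is new and non-zero.\<close>

lemma vacuum_sum:
  "(\<Sum>n=1..k. if odd n then (if k - n = 0 then 1 else 2 * (-1) ^ (k - n)) else 0) =
    - of_nat k * (-1 :: complex) ^ k"
proof (induction k rule: nat_induct2)
  case (step k)
  define g :: "nat \<Rightarrow> complex"
    where "g n = (if odd n then (if k + 2 - n = 0 then 1 else 2 * (-1) ^ (k + 2 - n)) else 0)" for n
  have "sum g {1..k + 2} = g 1 + (g 2 + sum g {3..k + 2})"
    using sum.atLeast_Suc_atMost[of 1 "k + 2" g] sum.atLeast_Suc_atMost[of 2 "k + 2" g]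
    by (simp add: numeral_2_eq_2[symmetric])
  also have "sum g {3..k + 2} = (\<Sum>n=1..k. if odd n then (if k - n = 0 then 1 else 2 * (-1) ^ (k - n)) else 0)"
    by (rule sum.reindex_bij_witness[of _ "\<lambda>n. n + 2" "\<lambda>n. n - 2"]) (auto simp: g_def)
  finally show ?case unfolding step.IH g_def by (simp add: algebra_simps)
qed auto

text \<open>Apply \<open>phi (int i)\<close> to Newton's identity for Q_i. Each product p_n Q_{i-n}
  contributes minus the value known for i - n, since \<open>phi (int i)\<close> kills Q_{i-n} by
  weight.\<close>

lemma phi_Q:
  assumes "i > 0"
  shows "phi (int i) (fps_nth Q_series i) = scale (2 * (-1) ^ i) 1"
  using assms
proof (induction i rule: less_induct)
  case (less i)
  let ?q = "fps_nth Q_series"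
  let ?c = "\<lambda>m. if m = 0 then 1 else 2 * (-1) ^ m :: complex"
  have IH: "phi (int m) (?q m) = scale (?c m) 1" if "m < i" for m
    using less.IH[OF that] by auto
  have step: "phi (int i) (power_sum n * ?q (i - n)) = - scale (?c (i - n)) 1"
    if n: "n > 0" "n \<le> i" for n
  proof -
    have "phi (int i) (?q (i - n)) = 0"
    proof (rule ccontr)
      assume "phi (int i) (?q (i - n)) \<noteq> 0"
      then obtain m where "m \<in> keys (phi (int i) (?q (i - n)))" by (metis ex_in_conv keys_eq_empty)
      then obtain b where b: "b \<in> keys (?q (i - n))" "int (weight b) = int (weight m) + int i"
        using weight_phi by blast
      have "int (weight b) = int (i - n)"
        by (rule weight_Qz) (simp only: Qz_of_nat b(1))
      then show False using b(2) n by simp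
    qed
    moreover have "int i - int n = int (i - n)" using n by simp
    ultimately show ?thesis
      using IH[of "i - n"] n by (simp add: phi_power_sum_mult)
  qed
  have "scale (of_nat i) (phi (int i) (?q i)) = phi (int i) (scale (of_nat i) (?q i))"
    by (simp add: linop_scale[OF linop_phi])
  also have "\<dots> = (\<Sum>n=1..i. if odd n then scale 2 (- scale (?c (i - n)) 1) else 0)"
    unfolding newton_Q linop_sum[OF linop_phi]
    by (rule sum.cong) (auto simp: linop_scale[OF linop_phi] linop_0[OF linop_phi] step)
  also have "\<dots> = scale (-2 * (\<Sum>n=1..i. if odd n then ?c (i - n) else 0)) 1"
    unfolding sum_distrib_left scale_sum_left
    by (rule sum.cong) (simp_all add: scale_minus_left linop_minus[OF linop_scaled[OF linop_id]])
  also have "\<dots> = scale (of_nat i) (scale (2 * (-1) ^ i) 1)"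
    unfolding vacuum_sum by (simp add: mult_ac)
  finally have "scale (1 / of_nat i) (scale (of_nat i) (phi (int i) (?q i))) =
      scale (1 / of_nat i) (scale (of_nat i) (scale (2 * (-1) ^ i) 1))" by simp
  then show ?case using less.prems by simp
qed

section \<open>The anticommutation relations through their defect\<close>

definition ac_const :: "int \<Rightarrow> int \<Rightarrow> complex"
  where "ac_const i j = (if i + j = 0 then 2 * (-1) powi i else 0)"

text \<open>Brackets of the defect with p_n and p_n^perp for odd n are again defects with shifted
  indices, so its vanishing can be proved by induction.\<close>

definition ac_defect :: "int \<Rightarrow> int \<Rightarrow> sym \<Rightarrow> sym"
  where "ac_defect i j f = phi i (phi j f) + phi j (phi i f) - scale (ac_const i j) f"

lemma linop_ac_defect: "linop (ac_defect i j)"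
  unfolding ac_defect_def[abs_def]
  by (intro linop_minus_op linop_plus linop_comp[OF linop_phi linop_phi] linop_scaled[OF linop_id])

lemma ac_defect_commute: "ac_defect i j f = ac_defect j i f"
proof -
  have "ac_const i j = ac_const j i"
    by (auto simp: ac_const_def minus_one_powi even_add add_eq_0_iff)
  then show ?thesis by (simp add: ac_defect_def)
qed

lemma B_odd_ac_defect: "f \<in> B_odd \<Longrightarrow> ac_defect i j f \<in> B_odd"
  unfolding ac_defect_def diff_conv_add_uminus scale_minus_left[symmetric]
  by (intro B_odd_add B_odd_phi B_odd_scale)

lemma perp_ac_defect:
  assumes "odd n"
  shows "perp (power_sum n) (ac_defect i j f) = ac_defect i j (perp (power_sum n) f) +
    scale 2 (ac_defect (i + int n) j f + ac_defect i (j + int n) f)"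
proof -
  have n: "n > 0" using assms by (rule odd_pos)
  \<comment> \<open>Shifting by an odd \<open>n\<close> flips the sign, so the scalar terms of the
    two shifted defects cancel.\<close>
  have "ac_const (i + int n) j = - ac_const i (j + int n)"
    using assms by (auto simp: ac_const_def minus_one_powi)
  then show ?thesis
    using assms by (simp add: ac_defect_def perp_power_sum_phi[OF n] linop_add[OF linop_perp]
      linop_diff[OF linop_perp] linop_scale[OF linop_perp] linop_add[OF linop_phi]
      linop_scale[OF linop_phi]) (simp add: scale_2 scale_minus_left algebra_simps)
qed

lemma ac_defect_power_sum_mult:
  assumes "odd n"
  shows "ac_defect i j (power_sum n * f) = power_sum n * ac_defect i j f
    - ac_defect (i - int n) j f - ac_defect i (j - int n) f"
proof -
  have n: "n > 0" using assms by (rule odd_pos)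
  have "ac_const (i - int n) j = - ac_const i (j - int n)"
    using assms by (auto simp: ac_const_def minus_one_powi)
  then show ?thesis
    using assms by (simp add: ac_defect_def phi_power_sum_mult[OF n] linop_diff[OF linop_phi]
      scale_mult_right) (simp add: scale_minus_left scale_mult_left scale_mult_right algebra_simps)
qed

lemma weight_ac_defect_1:
  assumes "m \<in> keys (ac_defect i j 1)"
  shows "int (weight m) = - (i + j)"
proof -
  have *: "int (weight m) = - (i + j)" if key: "m \<in> keys (phi i (phi j 1))" for i j
  proof -
    obtain b where b: "b \<in> keys (phi j 1)" "int (weight b) = int (weight m) + i"
      using weight_phi[OF key] by blast
    obtain b' where "b' \<in> keys (1 :: sym)" "int (weight b') = int (weight b) + j"
      using weight_phi[OF b(1)] by blast
    then show ?thesis using b(2) by (simp add: weight_def)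
  qed
  have "m \<in> keys (phi i (phi j 1)) \<or> m \<in> keys (phi j (phi i 1)) \<or> m \<in> keys (scale (ac_const i j) (1::sym))"
    using assms unfolding ac_defect_def by (auto simp: in_keys_iff lookup_add lookup_minus)
  then show ?thesis
    using *[of i j] *[of j i]
    by (auto simp: ac_const_def weight_def in_keys_iff lookup_one when_def split: if_splits)
qed

text \<open>The defect has weight -(i + j). For i + j > 0 this is negative; for i + j = 0
  \<open>phi_Q\<close> gives the value; for i + j < 0 all derivations vanish, by induction or by
  \<open>B_odd\<close>, which leaves a constant, and positive weight excludes constants.\<close>

lemma ac_defect_1: "ac_defect i j 1 = 0"
proof (induction "nat (- (i + j))" arbitrary: i j rule: less_induct)
  case less
  consider "i + j > 0" | "i + j = 0" | "i + j < 0" by linarith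
  then show ?case
  proof cases
    case 1
    then have "keys (ac_defect i j 1) = {}" using weight_ac_defect_1 by fastforce
    then show ?thesis by simp
  next
    case 2
    have pos: "ac_defect (int k) (- int k) 1 = 0" for k
    proof (cases "k = 0")
      case True
      then show ?thesis by (simp add: ac_defect_def ac_const_def scale_2)
    next
      case False
      then show ?thesis
        by (simp add: ac_defect_def ac_const_def phi_1 linop_0[OF linop_phi] phi_Q)
    qed
    show ?thesis
    proof (cases "i \<ge> 0")
      case True
      then show ?thesis using pos[of "nat i"] 2 by (simp add: add_eq_0_iff)
    next
      case False
      then show ?thesis using pos[of "nat j"] 2 by (simp add: ac_defect_commute[of i] add_eq_0_iff)
    qed
  next
    case 3
    have "perp (power_sum n) (ac_defect i j 1) = 0" if n: "n > 0" for n
    proof (cases "even n")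
      case True
      then show ?thesis using n B_odd_ac_defect[OF B_odd_1, of i j] by (simp add: B_odd_iff)
    next
      case False
      moreover have "ac_defect (i + int n) j 1 = 0" "ac_defect i (j + int n) 1 = 0"
        using 3 n by (intro less; simp)+
      ultimately show ?thesis
        using n by (simp add: perp_ac_defect perp_power_sum_1 linop_0[OF linop_ac_defect])
    qed
    then have c: "ac_defect i j 1 = scale (lookup (ac_defect i j 1) 0) 1"
      by (rule constant_if_perp_0)
    have "0 \<notin> keys (ac_defect i j 1)" using 3 weight_ac_defect_1[of 0 i j] by (auto simp: weight_def)
    then show ?thesis using c by (simp add: in_keys_iff)
  qed
qed

text \<open>Splitting off one odd power sum leads to a monomial of smaller weight but with shifted
  indices, hence the induction with \<open>i\<close> and \<open>j\<close> arbitrary.\<close>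

lemma ac_defect_single:
  "\<forall>i \<in> keys m. odd (Suc i) \<Longrightarrow> ac_defect i j (Poly_Mapping.single m 1) = 0"
proof (induction "weight m" arbitrary: m i j rule: less_induct)
  case less
  show ?case
  proof (cases "m = 0")
    case True
    then show ?thesis using ac_defect_1 by simp
  next
    case False
    then obtain k where k: "lookup m k \<noteq> 0" by (metis poly_mapping_eqI lookup_zero)
    define m' where "m' = m - Poly_Mapping.single k 1"
    have m: "m = Poly_Mapping.single k 1 + m'"
      using k by (intro poly_mapping_eqI)
        (auto simp: m'_def lookup_add lookup_minus lookup_single when_def)
    have n: "odd (Suc k)" using less.prems k by (auto simp: in_keys_iff)
    have *: "ac_defect i j (Poly_Mapping.single m' 1) = 0" for i j
    proof (rule less.hyps)
      show "weight m' < weight m" by (simp add: m weight_add) (simp add: weight_def)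
      show "\<forall>i\<in>keys m'. odd (Suc i)"
        using less.prems by (auto simp: m'_def in_keys_iff lookup_minus)
    qed
    have "Poly_Mapping.single m 1 = power_sum (Suc k) * Poly_Mapping.single m' 1"
      by (simp add: power_sum_def mult_single m)
    then show ?thesis using ac_defect_power_sum_mult[OF n] * by simp
  qed
qed

theorem phi_anticommute:
  assumes "f \<in> B_odd"
  shows "phi i (phi j f) + phi j (phi i f) = scale (ac_const i j) f"
proof -
  have "ac_defect i j f = 0"
    by (rule linop_eqI[where G = "\<lambda>_. 0"])
      (use assms in \<open>auto simp: linop_ac_defect B_odd_def intro!: ac_defect_single linopI\<close>)
  then show ?thesis by (simp add: ac_defect_def)
qed


section \<open>Bounded below combinations of the operators \<open>\<phi>\<^sub>j\<close>\<close>

definition bounded_below :: "(int \<Rightarrow> complex) \<Rightarrow> bool"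
  where "bounded_below a \<longleftrightarrow> (\<exists>N. \<forall>j < N. a j = 0)"

definition fermion :: "(int \<Rightarrow> complex) \<Rightarrow> sym \<Rightarrow> sym"
  where "fermion a f = Sum_any (\<lambda>j. scale (a j) (phi j f))"

lemma Gamma_op_eq: "Gamma_op A i = fermion (A i)"
  by (simp add: fun_eq_iff Gamma_op_def fermion_def)

text \<open>Cutoffs are collected as conditions that hold eventually in \<open>M\<close>; one
  symmetric range \<open>{-M..M}\<close> then serves several vectors at once.\<close>

lemma eventually_at_top_int_ex: "\<forall>\<^sub>F M :: int in at_top. P M \<Longrightarrow> \<exists>M. P M"
  by (rule eventually_happens') auto

lemma eventually_phi_0: "\<forall>\<^sub>F M in at_top. \<forall>j > M. phi j f = 0"
proof -
  obtain N where "\<forall>j \<ge> N. phi j f = 0" using phi_eventually_0 by blast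
  then show ?thesis by (auto simp: eventually_at_top_linorder intro!: exI[of _ N])
qed

lemma eventually_coeff_0:
  assumes "bounded_below a"
  shows "\<forall>\<^sub>F M in at_top. \<forall>j < - M. a j = 0"
proof -
  obtain N where "\<forall>j < N. a j = 0" using assms by (auto simp: bounded_below_def)
  then show ?thesis by (auto simp: eventually_at_top_linorder intro!: exI[of _ "- N"])
qed

lemma fermion_superset:
  assumes "finite S" "\<And>j. j \<notin> S \<Longrightarrow> a j = 0 \<or> phi j f = 0"
  shows "fermion a f = (\<Sum>j\<in>S. scale (a j) (phi j f))"
  unfolding fermion_def using assms(2) by (intro Sum_any.expand_superset assms(1)) force

lemma fermion_eq:
  assumes "\<forall>j < - M. a j = 0" "\<forall>j > M. phi j f = 0"
  shows "fermion a f = (\<Sum>j\<in>{-M..M}. scale (a j) (phi j f))"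
  by (rule fermion_superset) (use assms in force)+

lemma linop_fermion:
  assumes a: "bounded_below a"
  shows "linop (fermion a)"
proof (rule linopI)
  fix f g
  have "\<forall>\<^sub>F M in at_top. (\<forall>j < - M. a j = 0) \<and> (\<forall>j > M. phi j f = 0) \<and> (\<forall>j > M. phi j g = 0)"
    by (intro eventually_conj eventually_coeff_0[OF a] eventually_phi_0)
  then obtain M where M: "\<forall>j < - M. a j = 0" "\<forall>j > M. phi j f = 0" "\<forall>j > M. phi j g = 0"
    by (blast dest: eventually_at_top_int_ex)
  then have "\<forall>j > M. phi j (f + g) = 0" by (simp add: linop_add[OF linop_phi])
  then show "fermion a (f + g) = fermion a f + fermion a g"
    by (simp add: fermion_eq[OF M(1)] M linop_add[OF linop_phi] scale_add sum.distrib)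
next
  fix c f
  have "\<forall>\<^sub>F M in at_top. (\<forall>j < - M. a j = 0) \<and> (\<forall>j > M. phi j f = 0)"
    by (intro eventually_conj eventually_coeff_0[OF a] eventually_phi_0)
  then obtain M where M: "\<forall>j < - M. a j = 0" "\<forall>j > M. phi j f = 0"
    by (blast dest: eventually_at_top_int_ex)
  then have "\<forall>j > M. phi j (scale c f) = 0" by (simp add: linop_scale[OF linop_phi])
  then show "fermion a (scale c f) = scale c (fermion a f)"
    by (simp add: fermion_eq[OF M(1)] M linop_scale[OF linop_phi] scale_sum mult.commute)
qed

text \<open>An infinite support gives the default value 0, which lies in \<open>B_odd\<close>, so
  the closure properties handle every family \<open>a\<close>.\<close>

lemma B_odd_fermion: "f \<in> B_odd \<Longrightarrow> fermion a f \<in> B_odd"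
  unfolding fermion_def Sum_any.expand_set by (intro B_odd_sum B_odd_scale B_odd_phi)

text \<open>Summing \<open>phi_anticommute\<close> over j leaves only j = -n; the cutoff is at least
  |n| so that this index is in range.\<close>

lemma fermion_anticommute:
  assumes a: "bounded_below a" and f: "f \<in> B_odd"
  shows "fermion a (phi n f) + phi n (fermion a f) = scale (2 * (-1) powi n * a (- n)) f"
proof -
  have "\<forall>\<^sub>F M in at_top. (\<forall>j < - M. a j = 0) \<and> (\<forall>j > M. phi j f = 0)
      \<and> (\<forall>j > M. phi j (phi n f) = 0) \<and> M \<ge> \<bar>n\<bar>"
    by (intro eventually_conj eventually_coeff_0[OF a] eventually_phi_0 eventually_ge_at_top)
  then obtain M where M: "\<forall>j < - M. a j = 0" "\<forall>j > M. phi j f = 0" "\<forall>j > M. phi j (phi n f) = 0"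
      "M \<ge> \<bar>n\<bar>"
    by (blast dest: eventually_at_top_int_ex)
  have "fermion a (phi n f) + phi n (fermion a f) =
      (\<Sum>j\<in>{-M..M}. scale (a j) (phi j (phi n f) + phi n (phi j f)))"
    by (simp add: fermion_eq[OF M(1)] M linop_sum[OF linop_phi] linop_scale[OF linop_phi]
      scale_add sum.distrib)
  also have "\<dots> = (\<Sum>j\<in>{-M..M}. if j = - n then scale (2 * (-1) powi n * a (- n)) f else 0)"
    by (rule sum.cong) (auto simp: phi_anticommute[OF f] ac_const_def minus_one_powi mult.commute[of _ "2 :: complex"])
  also have "\<dots> = scale (2 * (-1) powi n * a (- n)) f"
    using M(4) by (subst sum.delta) auto
  finally show ?thesis .
qed

text \<open>With X = \<open>fermion a\<close>, moving the outer X past each \<open>phi j\<close> of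
  the inner one turns X (X f) into a scalar multiple of f minus X (X f).\<close>

lemma fermion_square:
  assumes a: "bounded_below a" and f: "f \<in> B_odd"
    and M: "\<forall>j < - M. a j = 0" "\<forall>j > M. phi j f = 0"
  shows "scale 2 (fermion a (fermion a f)) =
    scale (\<Sum>j\<in>{-M..M}. 2 * (-1) powi j * a j * a (- j)) f"
proof -
  let ?c = "\<lambda>j. 2 * (-1) powi j * a (- j)"
  have ac: "fermion a (phi j f) = scale (?c j) f - phi j (fermion a f)" for j
    using fermion_anticommute[OF a f, of j] by (simp add: algebra_simps)
  have "\<forall>\<^sub>F N in at_top. (\<forall>j > N. phi j (fermion a f) = 0) \<and> N \<ge> M"
    by (intro eventually_conj eventually_phi_0 eventually_ge_at_top)
  then obtain N where N: "\<forall>j > N. phi j (fermion a f) = 0" "N \<ge> M"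
    by (blast dest: eventually_at_top_int_ex)
  have N': "\<forall>j < - N. a j = 0" "\<forall>j > N. phi j f = 0" using M N(2) by auto
  have "fermion a (fermion a f) = (\<Sum>j\<in>{-N..N}. scale (a j) (fermion a (phi j f)))"
    unfolding fermion_eq[OF N'] by (simp add: linop_sum linop_scale linop_fermion[OF a])
  also have "\<dots> = scale (\<Sum>j\<in>{-N..N}. a j * ?c j) f - fermion a (fermion a f)"
    by (simp add: ac scale_diff sum_subtractf scale_sum_left fermion_eq[OF N'(1) N(1)])
  finally have "scale 2 (fermion a (fermion a f)) = scale (\<Sum>j\<in>{-N..N}. a j * ?c j) f"
    by (simp add: scale_2 algebra_simps)
  \<comment> \<open>Outside \<open>{-M..M}\<close> either \<open>a j\<close> or
    \<open>a (- j)\<close> vanishes.\<close>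
  also have "(\<Sum>j\<in>{-N..N}. a j * ?c j) = (\<Sum>j\<in>{-M..M}. 2 * (-1) powi j * a j * a (- j))"
    by (rule sum.mono_neutral_cong_right) (use M N in \<open>force simp: mult_ac\<close>)+
  finally show ?thesis .
qed


section \<open>The bilinear identity\<close>

lemma lookup_tensor: "lookup (tensor f g) (m, n) = lookup f m * lookup g n"
proof -
  have "lookup (tensor f g) (m, n) =
      (\<Sum>a\<in>keys f. \<Sum>b\<in>keys g. if a = m \<and> b = n then lookup f a * lookup g b else 0)"
    by (simp add: tensor_def lookup_sum lookup_single when_def)
  also have "\<dots> = (\<Sum>a\<in>keys f. if a = m then lookup f m * lookup g n else 0)"
  proof (rule sum.cong)
    fix a
    have "(\<Sum>b\<in>keys g. if b = n then lookup f m * lookup g b else 0) = lookup f m * lookup g n"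
      by (simp add: sum.delta' in_keys_iff)
    then show "(\<Sum>b\<in>keys g. if a = m \<and> b = n then lookup f a * lookup g b else 0) =
        (if a = m then lookup f m * lookup g n else 0)"
      by (cases "a = m") auto
  qed simp
  finally show ?thesis by (simp add: in_keys_iff)
qed

lemma linop_tensor_left: "linop (\<lambda>f. tensor f g)"
  and linop_tensor_right: "linop (\<lambda>g. tensor f g)"
  by (rule linopI; rule poly_mapping_eqI; rename_tac k; case_tac k;
      simp add: lookup_tensor lookup_add algebra_simps)+

lemma linop_tensor_op: "linop (tensor_op F G)"
proof -
  let ?c = "\<lambda>k. tensor (F (Poly_Mapping.single (fst k) 1)) (G (Poly_Mapping.single (snd k) 1))"
  have *: "tensor_op F G t = (\<Sum>k\<in>S. scale (lookup t k) (?c k))" if "finite S" "keys t \<subseteq> S" for t S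
    unfolding tensor_op_def by (rule sum.mono_neutral_left) (use that in \<open>auto simp: in_keys_iff\<close>)
  show ?thesis
  proof (rule linopI)
    fix s t
    show "tensor_op F G (s + t) = tensor_op F G s + tensor_op F G t"
      using *[of "keys s \<union> keys t" s] *[of "keys s \<union> keys t" t] *[of "keys s \<union> keys t" "s + t"]
      by (simp add: keys_add lookup_add scale_add_left sum.distrib)
  next
    fix c t
    show "tensor_op F G (scale c t) = scale c (tensor_op F G t)"
      using *[of "keys t" t] *[of "keys t" "scale c t"] by (simp add: keys_scale scale_sum)
  qed
qed

lemma tensor_op_tensor:
  assumes F: "linop F" and G: "linop G"
  shows "tensor_op F G (tensor f g) = tensor (F f) (G g)"
proof -
  let ?s = "\<lambda>m :: monom. Poly_Mapping.single m (1 :: complex)"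
  have 1: "tensor_op F G (tensor (?s a) (?s b)) = tensor (F (?s a)) (G (?s b))" for a b
    by (simp add: tensor_def[of "?s a"] tensor_op_def)
  have 2: "tensor_op F G (tensor (?s a) g) = tensor (F (?s a)) (G g)" for a
    by (rule linop_eqI[where f = g, OF linop_comp[OF linop_tensor_op linop_tensor_right]
        linop_comp[OF linop_tensor_right G] 1])
  show ?thesis
    by (rule linop_eqI[where f = f, OF linop_comp[OF linop_tensor_op linop_tensor_left]
        linop_comp[OF linop_tensor_left F] 2])
qed

lemma Omega_tensor:
  assumes "\<forall>j > M. phi j \<tau> = 0"
  shows "Omega (tensor \<tau> \<tau>) =
    (\<Sum>n\<in>{-M..M}. scale ((-1) powi n) (tensor (phi n \<tau>) (phi (- n) \<tau>)))"
proof -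
  have "Omega (tensor \<tau> \<tau>) = Sum_any (\<lambda>n. scale ((-1) powi n) (tensor (phi n \<tau>) (phi (- n) \<tau>)))"
    by (simp add: Omega_def tensor_op_tensor linop_phi linop_scaled linop_scale[OF linop_tensor_right])
  also have "\<dots> = (\<Sum>n\<in>{-M..M}. scale ((-1) powi n) (tensor (phi n \<tau>) (phi (- n) \<tau>)))"
  proof (rule Sum_any.expand_superset)
    show "{n. scale ((-1) powi n) (tensor (phi n \<tau>) (phi (- n) \<tau>)) \<noteq> 0} \<subseteq> {-M..M}"
    proof (rule subsetI, rule ccontr)
      fix n assume n: "n \<in> {n. scale ((-1) powi n) (tensor (phi n \<tau>) (phi (- n) \<tau>)) \<noteq> 0}" "n \<notin> {-M..M}"
      then have "phi n \<tau> = 0 \<or> phi (- n) \<tau> = 0" using assms by force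
      then show False using n(1) by auto
    qed
  qed simp
  finally show ?thesis .
qed

text \<open>The condition \<tau> \<noteq> 0 is left out because a fermion may annihilate a solution,
  while the bilinear identity survives.\<close>

definition BKP_bilinear :: "sym \<Rightarrow> bool"
  where "BKP_bilinear \<tau> \<longleftrightarrow> \<tau> \<in> B_odd \<and> Omega (tensor \<tau> \<tau>) = tensor \<tau> \<tau>"

lemma BKP_tau_iff: "BKP_tau \<tau> \<longleftrightarrow> BKP_bilinear \<tau> \<and> \<tau> \<noteq> 0"
  by (auto simp: BKP_tau_def BKP_bilinear_def)

lemma BKP_bilinear_1: "BKP_bilinear 1"
  using Omega_tensor[of 0 1] by (simp add: BKP_bilinear_def phi_1)

text \<open>Moving a combination \<open>X\<close> of the \<open>\<phi>\<^sub>j\<close> past \<open>\<phi>\<^sub>n \<otimes> \<phi>\<^bsub>-n\<^esub>\<close> on both sides produces, besides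
  \<open>(X \<otimes> X) \<Omega>\<close>, the scalar terms \<open>4 X\<^sup>2 - 2 X\<^sup>2 - 2 X\<^sup>2 = 0\<close>.\<close>

theorem BKP_bilinear_fermion:
  assumes a: "bounded_below a" and \<tau>: "BKP_bilinear \<tau>"
  shows "BKP_bilinear (fermion a \<tau>)"
proof -
  let ?X = "fermion a" and ?s = "\<lambda>n. (-1) powi n :: complex"
  define c where "c n = 2 * ?s n * a (- n)" for n
  have B: "\<tau> \<in> B_odd" and tau: "Omega (tensor \<tau> \<tau>) = tensor \<tau> \<tau>"
    using \<tau> by (auto simp: BKP_bilinear_def)
  note X = linop_fermion[OF a]
  have "\<forall>\<^sub>F M in at_top. (\<forall>j < - M. a j = 0) \<and> (\<forall>j > M. phi j \<tau> = 0) \<and> (\<forall>j > M. phi j (?X \<tau>) = 0)"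
    by (intro eventually_conj eventually_coeff_0[OF a] eventually_phi_0)
  then obtain M where M: "\<forall>j < - M. a j = 0" "\<forall>j > M. phi j \<tau> = 0" "\<forall>j > M. phi j (?X \<tau>) = 0"
    by (blast dest: eventually_at_top_int_ex)
  define C where "C = (\<Sum>j\<in>{-M..M}. 2 * ?s j * a j * a (- j))"
  have sq: "scale 2 (?X (?X \<tau>)) = scale C \<tau>"
    unfolding C_def by (rule fermion_square[OF a B M(1,2)])
  have XX: "(\<Sum>n\<in>{-M..M}. scale (2 * a n) (?X (phi n \<tau>))) = scale C \<tau>"
  proof -
    have "(\<Sum>n\<in>{-M..M}. scale (2 * a n) (?X (phi n \<tau>))) =
        scale 2 (?X (\<Sum>n\<in>{-M..M}. scale (a n) (phi n \<tau>)))"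
      by (simp add: linop_sum[OF X] linop_scale[OF X] scale_sum)
    then show ?thesis by (simp add: sq flip: fermion_eq[OF M(1,2)])
  qed
  have "phi n (?X \<tau>) = scale (c n) \<tau> - ?X (phi n \<tau>)" for n
    using fermion_anticommute[OF a B, of n] by (simp add: c_def algebra_simps)
  then have "Omega (tensor (?X \<tau>) (?X \<tau>)) = (\<Sum>n\<in>{-M..M}. scale (?s n)
      (tensor (scale (c n) \<tau> - ?X (phi n \<tau>)) (scale (c (- n)) \<tau> - ?X (phi (- n) \<tau>))))"
    by (simp add: Omega_tensor[OF M(3)])
  \<comment> \<open>In the mixed terms the sign inside \<open>c\<close> cancels \<open>?s n\<close>;
    the last term is X \<otimes> X applied to the n-th term of \<open>Omega\<close>.\<close>
  also have "\<dots> = (\<Sum>n\<in>{-M..M}. scale (?s n * c n * c (- n)) (tensor \<tau> \<tau>)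
      - tensor \<tau> (scale (2 * a (- n)) (?X (phi (- n) \<tau>)))
      - tensor (scale (2 * a n) (?X (phi n \<tau>))) \<tau>
      + tensor_op ?X ?X (scale (?s n) (tensor (phi n \<tau>) (phi (- n) \<tau>))))"
  proof (rule sum.cong)
    fix n
    have "?s n * c n = 2 * a (- n)" "?s n * c (- n) = 2 * a n" "a n * c n = a (- n) * c (- n)"
      by (auto simp: c_def minus_one_powi)
    then show "scale (?s n) (tensor (scale (c n) \<tau> - ?X (phi n \<tau>)) (scale (c (- n)) \<tau> - ?X (phi (- n) \<tau>))) =
      scale (?s n * c n * c (- n)) (tensor \<tau> \<tau>)
      - tensor \<tau> (scale (2 * a (- n)) (?X (phi (- n) \<tau>)))
      - tensor (scale (2 * a n) (?X (phi n \<tau>))) \<tau>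
      + tensor_op ?X ?X (scale (?s n) (tensor (phi n \<tau>) (phi (- n) \<tau>)))"
      by (simp add: linop_diff[OF linop_tensor_left] linop_diff[OF linop_tensor_right]
        linop_scale[OF linop_tensor_left] linop_scale[OF linop_tensor_right]
        linop_scale[OF linop_tensor_op] tensor_op_tensor[OF X X] scale_diff mult.assoc[symmetric])
        (simp add: mult.assoc)
  qed simp
  also have "\<dots> = scale (\<Sum>n\<in>{-M..M}. ?s n * c n * c (- n)) (tensor \<tau> \<tau>)
      - tensor \<tau> (\<Sum>n\<in>{-M..M}. scale (2 * a (- n)) (?X (phi (- n) \<tau>)))
      - tensor (\<Sum>n\<in>{-M..M}. scale (2 * a n) (?X (phi n \<tau>))) \<tau>
      + tensor_op ?X ?X (\<Sum>n\<in>{-M..M}. scale (?s n) (tensor (phi n \<tau>) (phi (- n) \<tau>)))"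
    by (simp only: sum.distrib sum_subtractf scale_sum_left linop_sum[OF linop_tensor_left]
      linop_sum[OF linop_tensor_right] linop_sum[OF linop_tensor_op])
  \<comment> \<open>By reflection both mixed sums equal \<open>scale C \<tau>\<close>, see
    \<open>XX\<close>; together they cancel the scalar term \<open>2 * C\<close>.\<close>
  also have "(\<Sum>n\<in>{-M..M}. scale (2 * a (- n)) (?X (phi (- n) \<tau>))) =
      (\<Sum>n\<in>{-M..M}. scale (2 * a n) (?X (phi n \<tau>)))"
    by (rule sum.reindex_bij_witness[of _ uminus uminus]) auto
  also have "(\<Sum>n\<in>{-M..M}. scale (?s n) (tensor (phi n \<tau>) (phi (- n) \<tau>))) = tensor \<tau> \<tau>"
    using Omega_tensor[OF M(2)] tau by simp
  also have "(\<Sum>n\<in>{-M..M}. ?s n * c n * c (- n)) = 2 * C"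
    unfolding C_def sum_distrib_left by (rule sum.cong) (auto simp: c_def minus_one_powi)
  also have "scale (2 * C) (tensor \<tau> \<tau>) = scale C (tensor \<tau> \<tau>) + scale C (tensor \<tau> \<tau>)"
    by (simp only: mult_2 scale_add_left)
  finally have "Omega (tensor (?X \<tau>) (?X \<tau>)) = tensor (?X \<tau>) (?X \<tau>)"
    by (simp add: XX linop_scale[OF linop_tensor_left] linop_scale[OF linop_tensor_right]
      tensor_op_tensor[OF X X])
  then show ?thesis using B_odd_fermion[OF B] by (simp add: BKP_bilinear_def)
qed


section \<open>Every polynomial tau-function is a product of fermions applied to the vacuum\<close>

lemma BKP_bilinear_lookup:
  assumes "BKP_bilinear \<tau>" "\<forall>j > M. phi j \<tau> = 0"
  shows "(\<Sum>n\<in>{-M..M}. (-1) powi n * lookup (phi n \<tau>) m * lookup (phi (- n) \<tau>) b) =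
    lookup \<tau> m * lookup \<tau> b"
proof -
  have "lookup (Omega (tensor \<tau> \<tau>)) (m, b) = lookup (tensor \<tau> \<tau>) (m, b)"
    using assms(1) by (simp add: BKP_bilinear_def)
  then show ?thesis
    by (simp add: Omega_tensor[OF assms(2)] lookup_tensor lookup_sum mult.assoc)
qed

lemma linop_perp_left: "linop (\<lambda>f. perp f g)"
  by (rule linopI) (simp_all add: perp_add_left perp_scale_left)

lemma perp_mult': "perp (f * g) h = perp f (perp g h)"
  unfolding perp_mult by (rule perp_commute)

text \<open>If \<open>k\<close> is the largest index with \<open>e\<^sub>k\<^sup>\<bottom> \<tau> \<noteq> 0\<close>, then \<open>\<phi>\<^sub>k \<tau> = (-1)\<^sup>k e\<^sub>k\<^sup>\<bottom> \<tau>\<close>.\<close>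

lemma vacuum_unique:
  assumes "\<And>n. n > 0 \<Longrightarrow> phi n \<tau> = 0"
  shows "\<tau> = scale (lookup \<tau> 0) 1"
proof -
  have e0: "perp (e_sym k) \<tau> = 0" if "k > 0" for k
  proof (rule ccontr)
    assume nz: "perp (e_sym k) \<tau> \<noteq> 0"
    obtain N where N: "\<forall>k \<ge> N. perp (e_sym k) \<tau> = 0" using perp_e_eventually_0 by blast
    define K where "K = (GREATEST k. perp (e_sym k) \<tau> \<noteq> 0)"
    have bound: "k \<le> N" if "perp (e_sym k) \<tau> \<noteq> 0" for k
      using N that nle_le by blast
    have K: "perp (e_sym K) \<tau> \<noteq> 0"
      unfolding K_def by (rule GreatestI_nat[of _ k N]) (use nz bound in auto)
    have le: "k \<le> K" if "perp (e_sym k) \<tau> \<noteq> 0" for k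
      unfolding K_def by (rule Greatest_le_nat[of _ k N]) (use that bound in auto)
    \<comment> \<open>For k < K the index of \<open>Qz\<close> is negative, so only the top term,
      with \<open>Qz 0 = 1\<close>, remains.\<close>
    have "phi (int K) \<tau> = (\<Sum>k<Suc K. scale ((-1) ^ k) (Qz (int k - int K) * perp (e_sym k) \<tau>))"
      by (rule phi_eq) (use le in force)
    also have "\<dots> = scale ((-1) ^ K) (perp (e_sym K) \<tau>)"
      by simp
    finally have "phi (int K) \<tau> \<noteq> 0" using K by (simp add: scale_eq_0_iff)
    moreover have "K > 0" using le[OF nz] that by simp
    ultimately show False using assms by simp
  qed
  \<comment> \<open>Adjoint of Newton's identity: e_{k-n}^perp kills \<tau> for n < k, and the term
    n = k is p_k^perp up to sign.\<close>
  have "perp (power_sum k) \<tau> = 0" if k: "k > 0" for k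
  proof -
    have "0 = perp (scale (of_nat k) (e_sym k)) \<tau>"
      using k by (simp add: perp_scale_left e0)
    also have "\<dots> = (\<Sum>n=1..k. scale ((-1) ^ (n - 1)) (perp (power_sum n) (perp (e_sym (k - n)) \<tau>)))"
      unfolding newton_e linop_sum[OF linop_perp_left]
      by (simp only: perp_scale_left perp_mult')
    also have "\<dots> = (\<Sum>n\<in>{k}. scale ((-1) ^ (n - 1)) (perp (power_sum n) (perp (e_sym (k - n)) \<tau>)))"
      by (rule sum.mono_neutral_right) (use k in \<open>auto simp: e0 linop_0[OF linop_perp]\<close>)
    finally show ?thesis by (simp add: scale_eq_0_iff)
  qed
  then show ?thesis by (rule constant_if_perp_0)
qed

text \<open>Pairing the bilinear identity with a functional that vanishes at \<open>\<tau>\<close> but not at \<open>\<phi>\<^sub>m \<tau>\<close> gives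
  a combination \<open>Y\<close> of the \<open>\<phi>\<^sub>j\<close> that kills \<open>\<tau>\<close> and has a non-zero \<open>\<phi>\<^bsub>-m\<^esub>\<close>-coefficient. Then
  \<open>Y \<phi>\<^sub>m \<tau> = Y \<phi>\<^sub>m \<tau> + \<phi>\<^sub>m Y \<tau>\<close> is a non-zero multiple of \<open>\<tau>\<close>.\<close>

lemma tau_eq_fermion_phi:
  assumes \<tau>: "BKP_bilinear \<tau>" "\<tau> \<noteq> 0" and m: "m > 0" "phi m \<tau> \<noteq> 0"
  obtains a where "bounded_below a" "\<tau> = fermion a (phi m \<tau>)"
proof -
  have B: "\<tau> \<in> B_odd" using \<tau>(1) by (simp add: BKP_bilinear_def)
  obtain M where M: "\<forall>j > M. phi j \<tau> = 0"
    using eventually_at_top_int_ex[OF eventually_phi_0] by blast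
  \<comment> \<open>A monomial \<nu> of top weight in \<tau> cannot occur in
    \<open>phi m \<tau>\<close>, because \<open>phi m\<close> lowers weights.\<close>
  define d where "d = Max (weight ` keys \<tau>)"
  have "d \<in> weight ` keys \<tau>" unfolding d_def using \<tau>(2) by (intro Max_in) auto
  then obtain \<nu> where \<nu>: "\<nu> \<in> keys \<tau>" "weight \<nu> = d" by auto
  have "lookup (phi m \<tau>) \<nu> = 0"
  proof (rule ccontr)
    assume "lookup (phi m \<tau>) \<nu> \<noteq> 0"
    then have "\<nu> \<in> keys (phi m \<tau>)" by (simp add: in_keys_iff)
    then obtain b where b: "b \<in> keys \<tau>" "int (weight b) = int (weight \<nu>) + m" by (rule weight_phi)
    then have "weight b \<le> d" by (simp add: d_def)
    then show False using b(2) \<nu>(2) m(1) by simp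
  qed
  moreover obtain \<mu> where \<mu>: "lookup (phi m \<tau>) \<mu> \<noteq> 0"
    using m(2) by (metis poly_mapping_eqI lookup_zero)
  \<comment> \<open>The coefficient at \<mu>, corrected by that at \<nu> so as to vanish on \<tau>;
    the correction does not affect the value on \<open>phi m \<tau>\<close>.\<close>
  moreover define \<psi> where "\<psi> f = lookup f \<mu> - lookup \<tau> \<mu> / lookup \<tau> \<nu> * lookup f \<nu>" for f :: sym
  ultimately have \<psi>m: "\<psi> (phi m \<tau>) \<noteq> 0" by simp
  have \<psi>\<tau>: "\<psi> \<tau> = 0" using \<nu>(1) by (simp add: \<psi>_def in_keys_iff)
  \<comment> \<open>The coefficient of \<open>phi j \<tau>\<close> when \<psi> is applied to the
    first factor of \<open>Omega (tensor \<tau> \<tau>)\<close>, with n = -j.\<close>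
  define y where "y j = (-1) powi j * \<psi> (phi (- j) \<tau>)" for j
  have y: "bounded_below y" "\<forall>j < - M. y j = 0"
    using M by (auto simp: bounded_below_def y_def \<psi>_def intro!: exI[of _ "- M"])
  have "lookup (fermion y \<tau>) b = 0" for b
  proof -
    have "lookup (fermion y \<tau>) b = (\<Sum>j\<in>{-M..M}. y j * lookup (phi j \<tau>) b)"
      by (simp add: fermion_eq[OF y(2) M] lookup_sum)
    also have "\<dots> = (\<Sum>n\<in>{-M..M}. (-1) powi n * \<psi> (phi n \<tau>) * lookup (phi (- n) \<tau>) b)"
      by (rule sum.reindex_bij_witness[of _ uminus uminus]) (auto simp: y_def minus_one_powi)
    also have "\<dots> = (\<Sum>n\<in>{-M..M}. (-1) powi n * lookup (phi n \<tau>) \<mu> * lookup (phi (- n) \<tau>) b)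
        - lookup \<tau> \<mu> / lookup \<tau> \<nu> *
          (\<Sum>n\<in>{-M..M}. (-1) powi n * lookup (phi n \<tau>) \<nu> * lookup (phi (- n) \<tau>) b)"
      unfolding \<psi>_def sum_distrib_left sum_subtractf[symmetric]
      by (rule sum.cong) (simp_all add: algebra_simps)
    also have "\<dots> = \<psi> \<tau> * lookup \<tau> b"
      unfolding BKP_bilinear_lookup[OF \<tau>(1) M] by (simp add: \<psi>_def algebra_simps)
    finally show ?thesis by (simp add: \<psi>\<tau>)
  qed
  then have "fermion y \<tau> = 0" by (intro poly_mapping_eqI) simp
  then have Y: "fermion y (phi m \<tau>) = scale (2 * \<psi> (phi m \<tau>)) \<tau>"
    using fermion_anticommute[OF y(1) B, of m]
    by (simp add: linop_0[OF linop_phi] y_def minus_one_powi)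
  define c where "c = 1 / (2 * \<psi> (phi m \<tau>))"
  define a where "a j = c * y j" for j
  have a: "bounded_below a" using y(1) by (auto simp: bounded_below_def a_def)
  have "\<forall>\<^sub>F N in at_top. (\<forall>j < - N. y j = 0) \<and> (\<forall>j > N. phi j (phi m \<tau>) = 0)"
    by (intro eventually_conj eventually_coeff_0[OF y(1)] eventually_phi_0)
  then obtain N where N: "\<forall>j < - N. y j = 0" "\<forall>j > N. phi j (phi m \<tau>) = 0"
    by (blast dest: eventually_at_top_int_ex)
  then have aN: "\<forall>j < - N. a j = 0" by (simp add: a_def)
  have "fermion a (phi m \<tau>) = scale c (fermion y (phi m \<tau>))"
    unfolding fermion_eq[OF aN N(2)] fermion_eq[OF N] by (simp add: a_def scale_sum)
  also have "\<dots> = \<tau>" using \<psi>m by (simp add: Y c_def)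
  finally show ?thesis using that a by simp
qed

lemma fermion_delta: "fermion (\<lambda>j. if j = m then c else 0) f = scale c (phi m f)"
  by (subst fermion_superset[of "{m}"]) auto

lemma bounded_below_delta: "bounded_below (\<lambda>j. if j = m then c else 0)"
  by (auto simp: bounded_below_def intro!: exI[of _ m])

text \<open>Induction on a bound for the weights: \<open>tau_eq_fermion_phi\<close> reduces \<tau>
  to \<open>phi m \<tau>\<close>, a solution of weight at most d - m. If no such m exists, \<tau> is
  constant by \<open>vacuum_unique\<close>.\<close>

lemma tau_eq_foldr_fermion:
  assumes "BKP_bilinear \<tau>" "\<tau> \<noteq> 0" "\<And>m. m \<in> keys \<tau> \<Longrightarrow> weight m \<le> d"
  shows "\<exists>as. as \<noteq> [] \<and> (\<forall>a \<in> set as. bounded_below a) \<and> \<tau> = foldr fermion as 1"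
  using assms
proof (induction d arbitrary: \<tau> rule: less_induct)
  case (less d)
  show ?case
  proof (cases "\<forall>m > 0. phi m \<tau> = 0")
    case True
    then have "\<tau> = scale (lookup \<tau> 0) 1" by (intro vacuum_unique) simp
    \<comment> \<open>Since \<open>phi 0 1 = 1\<close>, a constant is one fermion applied to the
      vacuum, which keeps the list non-empty.\<close>
    also have "\<dots> = foldr fermion [\<lambda>j. if j = 0 then lookup \<tau> 0 else 0] 1"
      by (simp add: fermion_delta)
    finally show ?thesis
      by (intro exI[of _ "[\<lambda>j. if j = 0 then lookup \<tau> 0 else 0]"]) (simp add: bounded_below_delta)
  next
    case False
    then obtain m where m: "m > 0" "phi m \<tau> \<noteq> 0" by blast
    obtain a where a: "bounded_below a" "\<tau> = fermion a (phi m \<tau>)"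
      using tau_eq_fermion_phi[OF less.prems(1,2) m] .
    have w: "int (weight k) + m \<le> int d" if k: "k \<in> keys (phi m \<tau>)" for k
    proof -
      obtain b where "b \<in> keys \<tau>" "int (weight b) = int (weight k) + m" using weight_phi[OF k] .
      then show ?thesis using less.prems(3)[of b] by simp
    qed
    \<comment> \<open>A monomial of \<open>phi m \<tau>\<close> shows m \<le> d, so that
      \<open>nat (int d - m)\<close> is not truncated and the bound drops.\<close>
    obtain k where "k \<in> keys (phi m \<tau>)" using m(2) by (metis ex_in_conv keys_eq_empty)
    from w[OF this] have "nat (int d - m) < d" using m(1) by linarith
    moreover have "BKP_bilinear (phi m \<tau>)"
      using BKP_bilinear_fermion[OF bounded_below_delta less.prems(1), of m 1]
      by (simp add: fermion_delta)
    moreover have "weight k \<le> nat (int d - m)" if "k \<in> keys (phi m \<tau>)" for k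
      using w[OF that] by linarith
    ultimately obtain as where "as \<noteq> []" "\<forall>a \<in> set as. bounded_below a" "phi m \<tau> = foldr fermion as 1"
      using less.IH m(2) by blast
    then show ?thesis using a by (intro exI[of _ "a # as"]) simp
  qed
qed

section \<open>Passage between lists of fermions and matrices\<close>

lemma rows_bounded_below_iff: "rows_bounded_below A \<longleftrightarrow> (\<forall>i. bounded_below (A i))"
  by (simp add: rows_bounded_below_def bounded_below_def)

lemma Q_tilde_eq_foldr: "Q_tilde A ls = foldr fermion (map (\<lambda>l. A (- l)) ls) 1"
  by (simp add: Q_tilde_def Gamma_op_eq foldr_map comp_def)

lemma BKP_tau_imp_Q_tilde:
  assumes "BKP_tau \<tau>"
  shows "\<exists>A ls. rows_bounded_below A \<and> ls \<noteq> [] \<and> \<tau> = Q_tilde A ls"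
proof -
  have "weight m \<le> Max (weight ` keys \<tau>)" if "m \<in> keys \<tau>" for m using that by simp
  then obtain as where as: "as \<noteq> []" "\<forall>a \<in> set as. bounded_below a" "\<tau> = foldr fermion as 1"
    using tau_eq_foldr_fermion[of \<tau> "Max (weight ` keys \<tau>)"] assms by (auto simp: BKP_tau_iff)
  \<comment> \<open>The index vector will be (0, ..., l-1): row -i carries the i-th family, counted
    from 0, and all other rows are zero.\<close>
  define A where "A i = (if 0 \<le> - i \<and> - i < int (length as) then as ! nat (- i) else (\<lambda>_. 0))" for i
  have "map (\<lambda>l. A (- l)) (map int [0..<length as]) = as"
    by (rule nth_equalityI) (auto simp: A_def)
  then have "\<tau> = Q_tilde A (map int [0..<length as])"
    unfolding Q_tilde_eq_foldr by (simp only: as(3))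
  moreover have "rows_bounded_below A"
    unfolding rows_bounded_below_iff using as(2) by (auto simp: A_def bounded_below_def all_set_conv_all_nth)
  ultimately show ?thesis using as(1) by (intro exI[of _ A] exI[of _ "map int [0..<length as]"]) simp
qed

lemma BKP_bilinear_Q_tilde:
  assumes "rows_bounded_below A"
  shows "BKP_bilinear (Q_tilde A ls)"
  using assms by (induction ls)
    (auto simp: Q_tilde_eq_foldr BKP_bilinear_1 rows_bounded_below_iff intro: BKP_bilinear_fermion)


section \<open>Expansions\<close>

lemma has_finite_sumI:
  assumes "finite F" "F \<subseteq> I" "\<And>i. i \<in> I - F \<Longrightarrow> f i = 0" "S = sum f F"
  shows "has_finite_sum f I S"
proof -
  have sub: "{i \<in> I. f i \<noteq> 0} \<subseteq> F" using assms(3) by auto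
  moreover have "sum f {i \<in> I. f i \<noteq> 0} = sum f F"
    by (rule sum.mono_neutral_left) (use assms(1,2) sub in auto)
  ultimately show ?thesis using assms(1,4) by (auto simp: has_finite_sum_def intro: finite_subset)
qed

lemma has_finite_sum_superset:
  assumes "has_finite_sum f I S" "finite F" "{i \<in> I. f i \<noteq> 0} \<subseteq> F" "F \<subseteq> I"
  shows "S = sum f F"
  using assms unfolding has_finite_sum_def
  by (auto intro!: sum.mono_neutral_left)

lemma has_finite_sum_reflect:
  assumes "has_finite_sum f UNIV S"
  shows "has_finite_sum (\<lambda>k :: int. f (- k)) UNIV S"
proof (rule has_finite_sumI)
  let ?F = "{k. f k \<noteq> 0}"
  show "finite (uminus ` ?F)" using assms by (simp add: has_finite_sum_def)
  show "S = (\<Sum>k \<in> uminus ` ?F. f (- k))"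
    using assms by (simp add: has_finite_sum_def sum.reindex)
  show "f (- k) = 0" if "k \<in> UNIV - uminus ` ?F" for k
    using that by (auto simp: image_iff)
qed simp

lemma has_finite_sum_lincomb:
  fixes f :: "'j \<Rightarrow> 'i \<Rightarrow> complex"
  assumes J: "finite J" and f: "\<And>j. has_finite_sum (f j) UNIV (s j)"
  shows "has_finite_sum (\<lambda>k. \<Sum>j\<in>J. c j * f j k) UNIV (\<Sum>j\<in>J. c j * s j)"
proof (rule has_finite_sumI)
  let ?F = "\<Union>j\<in>J. {k. f j k \<noteq> 0}"
  show fin: "finite ?F" using J f by (auto simp: has_finite_sum_def)
  show "(\<Sum>j\<in>J. c j * f j k) = 0" if "k \<in> UNIV - ?F" for k
    using that by (intro sum.neutral) auto
  have "s j = sum (f j) ?F" if "j \<in> J" for j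
    by (rule has_finite_sum_superset[OF f fin]) (use that in auto)
  then have "(\<Sum>j\<in>J. c j * s j) = (\<Sum>j\<in>J. \<Sum>k\<in>?F. c j * f j k)"
    by (simp add: sum_distrib_left)
  also have "\<dots> = (\<Sum>k\<in>?F. \<Sum>j\<in>J. c j * f j k)" by (rule sum.swap)
  finally show "(\<Sum>j\<in>J. c j * s j) = (\<Sum>k\<in>?F. \<Sum>j\<in>J. c j * f j k)" .
qed simp

section \<open>Expansion of \<open>Q_tilde\<close> in the functions \<open>Q_coeff\<close>\<close>

definition Q_term :: "(int \<Rightarrow> int \<Rightarrow> complex) \<Rightarrow> int list \<Rightarrow> int list \<Rightarrow> sym"
  where "Q_term A ls \<alpha> = scale (\<Prod>i < length ls. A (- (ls ! i)) (- (\<alpha> ! i))) (Q_coeff \<alpha>)"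

lemma Q_term_Cons: "Q_term A (l # ls) (a # \<alpha>) = scale (A (- l) (- a)) (phi (- a) (Q_term A ls \<alpha>))"
  by (simp add: Q_term_def Q_coeff_def prod.lessThan_Suc_shift linop_scale[OF linop_phi] del: prod.lessThan_Suc)

text \<open>The index set grows from the innermost operator outwards: the row bounds the new index
  on one side, and the vanishing of \<open>phi j\<close> for large j on the finitely many earlier
  terms bounds it on the other.\<close>

lemma Q_tilde_expansion:
  assumes A: "rows_bounded_below A"
  shows "\<exists>F. finite F \<and> F \<subseteq> {\<alpha>. length \<alpha> = length ls} \<and>
    (\<forall>\<alpha>. length \<alpha> = length ls \<longrightarrow> \<alpha> \<notin> F \<longrightarrow> Q_term A ls \<alpha> = 0) \<and> Q_tilde A ls = sum (Q_term A ls) F"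
proof (induction ls)
  case Nil
  show ?case by (intro exI[of _ "{[]}"]) (auto simp: Q_term_def Q_tilde_def Q_coeff_def)
next
  case (Cons l ls)
  then obtain F where F: "finite F" "F \<subseteq> {\<alpha>. length \<alpha> = length ls}"
      "\<And>\<alpha>. length \<alpha> = length ls \<Longrightarrow> \<alpha> \<notin> F \<Longrightarrow> Q_term A ls \<alpha> = 0" "Q_tilde A ls = sum (Q_term A ls) F"
    by blast
  have a: "bounded_below (A (- l))" using A by (simp add: rows_bounded_below_iff)
  have "\<forall>\<^sub>F M in at_top. (\<forall>j < - M. A (- l) j = 0) \<and> (\<forall>\<alpha>\<in>F. \<forall>j > M. phi j (Q_term A ls \<alpha>) = 0)"
    by (intro eventually_conj eventually_coeff_0[OF a] eventually_ball_finite F(1) ballI eventually_phi_0)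
  then obtain M where M: "\<forall>j < - M. A (- l) j = 0" "\<And>\<alpha>. \<alpha> \<in> F \<Longrightarrow> \<forall>j > M. phi j (Q_term A ls \<alpha>) = 0"
    by (blast dest: eventually_at_top_int_ex)
  let ?cons = "\<lambda>(a, \<alpha>). a # \<alpha>"
  let ?G = "?cons ` ({-M..M} \<times> F)"
  have "Q_term A (l # ls) \<beta> = 0" if \<beta>: "length \<beta> = length (l # ls)" "\<beta> \<notin> ?G" for \<beta>
  proof -
    obtain a \<alpha> where \<beta>': "\<beta> = a # \<alpha>" "length \<alpha> = length ls" using \<beta>(1) by (cases \<beta>) auto
    show ?thesis
    proof (cases "\<alpha> \<in> F")
      case True
      then have "a \<notin> {-M..M}" using \<beta>(2) \<beta>'(1) by force
      then have "A (- l) (- a) = 0 \<or> phi (- a) (Q_term A ls \<alpha>) = 0" using M(1) M(2)[OF True] by force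
      then show ?thesis by (auto simp: \<beta>'(1) Q_term_Cons)
    qed (simp add: \<beta>' Q_term_Cons F(3) linop_0[OF linop_phi])
  qed
  moreover have "Q_tilde A (l # ls) = sum (Q_term A (l # ls)) ?G"
  proof -
    have "Q_tilde A (l # ls) = fermion (A (- l)) (Q_tilde A ls)"
      by (simp add: Q_tilde_def Gamma_op_eq)
    also have "\<dots> = (\<Sum>\<alpha>\<in>F. fermion (A (- l)) (Q_term A ls \<alpha>))"
      by (simp add: F(4) linop_sum[OF linop_fermion[OF a]])
    also have "\<dots> = (\<Sum>\<alpha>\<in>F. \<Sum>j\<in>{-M..M}. scale (A (- l) j) (phi j (Q_term A ls \<alpha>)))"
      by (rule sum.cong) (simp_all add: fermion_eq[OF M(1) M(2)])
    also have "\<dots> = (\<Sum>\<alpha>\<in>F. \<Sum>a\<in>{-M..M}. Q_term A (l # ls) (a # \<alpha>))"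
      unfolding Q_term_Cons
      by (intro sum.cong refl sum.reindex_bij_witness[of _ uminus uminus]) auto
    also have "\<dots> = (\<Sum>p\<in>{-M..M} \<times> F. Q_term A (l # ls) (?cons p))"
      by (subst sum.swap) (simp add: sum.cartesian_product split_def)
    also have "\<dots> = sum (Q_term A (l # ls)) ?G"
      by (subst sum.reindex) (auto simp: inj_on_def comp_def)
    finally show ?thesis .
  qed
  ultimately show ?case
    using F(1,2) by (intro exI[of _ ?G] conjI allI impI) (auto simp del: length_Cons)
qed

lemma Q_tilde_has_finite_sum:
  assumes "rows_bounded_below A"
  shows "has_finite_sum (Q_term A ls) {\<alpha>. length \<alpha> = length ls} (Q_tilde A ls)"
proof -
  obtain F where "finite F" "F \<subseteq> {\<alpha>. length \<alpha> = length ls}"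
    "\<forall>\<alpha>. length \<alpha> = length ls \<longrightarrow> \<alpha> \<notin> F \<longrightarrow> Q_term A ls \<alpha> = 0" "Q_tilde A ls = sum (Q_term A ls) F"
    using Q_tilde_expansion[OF assms] by blast
  then show ?thesis by (intro has_finite_sumI[of F]) auto
qed

section \<open>Re-expansion of \<open>Q_coeff\<close> by iterated sums\<close>

lemma has_iterated_sum_cong:
  assumes "\<And>ks. length ks = l \<Longrightarrow> f ks = g ks"
  shows "has_iterated_sum l f S \<longleftrightarrow> has_iterated_sum l g S"
  using assms
proof (induction l arbitrary: f g S)
  case (Suc l)
  have "has_iterated_sum l (\<lambda>ks. f (ks @ [k])) T \<longleftrightarrow> has_iterated_sum l (\<lambda>ks. g (ks @ [k])) T" for k T
    by (rule Suc.IH) (simp add: Suc.prems)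
  then show ?case by simp
qed simp

abbreviation phi_prod :: "int list \<Rightarrow> sym \<Rightarrow> sym"
  where "phi_prod rs v \<equiv> foldr (\<lambda>a f. phi (- a) f) rs v"

lemma linop_phi_prod: "linop (phi_prod rs)"
  by (induction rs) (simp_all add: linop_id linop_comp[OF linop_phi])

lemma weight_phi_prod:
  "m \<in> keys (phi_prod rs f) \<Longrightarrow> \<exists>b \<in> keys f. int (weight b) = int (weight m) - sum_list rs"
proof (induction rs arbitrary: m)
  case (Cons r rs)
  then obtain b where "b \<in> keys (phi_prod rs f)" "int (weight b) = int (weight m) - r"
    using weight_phi[of m "- r"] by auto
  moreover from this obtain b' where "b' \<in> keys f" "int (weight b') = int (weight b) - sum_list rs"
    using Cons.IH by blast
  ultimately show ?case by (intro bexI[of _ b']) simp_all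
qed auto

text \<open>A fixed monomial occurs in \<open>\<phi>\<^bsub>-r\<^sub>1\<^esub> \<cdots> \<phi>\<^bsub>-r\<^sub>l\<^esub> \<phi>\<^sub>j v\<close> for only finitely many \<open>j\<close>; this allows
  the sums over the rows of \<open>A\<close> and over the outermost summation index to be interchanged.\<close>

lemma has_formal_sum_phi_prod:
  assumes A: "rows_bounded_below A" and BA: "left_inverse B A"
  shows "has_formal_sum (\<lambda>k. phi_prod rs (scale (B (- r) (- k)) (fermion (A (- k)) v))) UNIV
    (phi_prod rs (phi (- r) v))"
  unfolding has_formal_sum_def
proof
  fix m
  define c where "c j = lookup (phi_prod rs (phi j v)) m" for j
  \<comment> \<open>By weight \<open>c j\<close> can be non-zero only for these j; the set does not
    depend on the summation index k.\<close>
  define J where "J = (\<lambda>b. int (weight b) - int (weight m) + sum_list rs) ` keys v"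
  have c0: "c j = 0" if "j \<notin> J" for j
  proof (rule ccontr)
    assume "c j \<noteq> 0"
    then have "m \<in> keys (phi_prod rs (phi j v))" by (simp add: c_def in_keys_iff)
    then obtain b where b: "b \<in> keys (phi j v)" "int (weight b) = int (weight m) - sum_list rs"
      using weight_phi_prod by blast
    obtain b' where "b' \<in> keys v" "int (weight b') = int (weight b) + j" using weight_phi[OF b(1)] .
    then have "j \<in> J" using b(2) by (force simp: J_def)
    then show False using that by blast
  qed
  have J: "finite J" by (simp add: J_def)
  have T: "lookup (phi_prod rs (scale (B (- r) (- k)) (fermion (A (- k)) v))) m =
      (\<Sum>j\<in>J. c j * (B (- r) (- k) * A (- k) j))" for k
  proof -
    have "\<forall>\<^sub>F M in at_top. (\<forall>j < - M. A (- k) j = 0) \<and> (\<forall>j > M. phi j v = 0)"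
      using A by (intro eventually_conj eventually_coeff_0 eventually_phi_0) (simp add: rows_bounded_below_iff)
    then obtain M where M: "\<forall>j < - M. A (- k) j = 0" "\<forall>j > M. phi j v = 0"
      by (blast dest: eventually_at_top_int_ex)
    \<comment> \<open>\<open>M\<close> varies with \<open>k\<close>; including \<open>J\<close> in
      the range allows the sum to be cut back to \<open>J\<close> alone.\<close>
    have "fermion (A (- k)) v = (\<Sum>j\<in>{-M..M} \<union> J. scale (A (- k) j) (phi j v))"
      by (rule fermion_superset) (use J M in force)+
    then have "lookup (phi_prod rs (scale (B (- r) (- k)) (fermion (A (- k)) v))) m =
        (\<Sum>j\<in>{-M..M} \<union> J. c j * (B (- r) (- k) * A (- k) j))"
      by (simp add: scale_sum linop_sum[OF linop_phi_prod] linop_scale[OF linop_phi_prod] lookup_sum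
        c_def mult_ac)
    also have "\<dots> = (\<Sum>j\<in>J. c j * (B (- r) (- k) * A (- k) j))"
      by (rule sum.mono_neutral_right) (use J c0 in auto)
    finally show ?thesis .
  qed
  \<comment> \<open>For each j in \<open>J\<close> the sum over k is an entry of the product of
    \<open>B\<close> and \<open>A\<close>, with k reflected.\<close>
  have "has_finite_sum (\<lambda>k. \<Sum>j\<in>J. c j * (B (- r) (- k) * A (- k) j)) UNIV
      (\<Sum>j\<in>J. c j * (if - r = j then 1 else 0))"
    by (rule has_finite_sum_lincomb[OF J], rule has_finite_sum_reflect)
      (use BA in \<open>simp add: left_inverse_def\<close>)
  moreover have "(\<Sum>j\<in>J. c j * (if - r = j then 1 else 0)) = c (- r)"
    using J c0[of "- r"] by (simp add: if_distrib[of "(*) _"] sum.delta' cong: if_cong)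
  ultimately show "has_finite_sum (\<lambda>k. lookup (phi_prod rs (scale (B (- r) (- k)) (fermion (A (- k)) v))) m)
      UNIV (lookup (phi_prod rs (phi (- r) v)) m)"
    by (simp add: T c_def)
qed

lemma g_prod_coeff_snoc:
  "length ks = length rs \<Longrightarrow>
    g_prod_coeff B (ks @ [k]) (rs @ [r]) = g_prod_coeff B ks rs * B (- r) (- k)"
  by (simp add: g_prod_coeff_def g_coeff_def nth_append)

text \<open>The last operator acts first and its index is summed outermost. Removing it from the
  right replaces \<open>v\<close> by the vector it produces, hence the arbitrary
  \<open>v\<close>.\<close>

lemma has_iterated_sum_Q_tilde:
  assumes A: "rows_bounded_below A" and BA: "left_inverse B A"
  shows "has_iterated_sum (length rs)
    (\<lambda>ls. scale (g_prod_coeff B ls rs) (foldr (\<lambda>l. fermion (A (- l))) ls v)) (phi_prod rs v)"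
proof (induction rs arbitrary: v rule: rev_induct)
  case Nil
  show ?case by (simp add: g_prod_coeff_def)
next
  case (snoc r rs)
  have lin: "linop (foldr (\<lambda>l. fermion (A (- l))) ks)" for ks
  proof (induction ks)
    case (Cons l ks)
    have "bounded_below (A (- l))" using A by (simp add: rows_bounded_below_iff)
    from linop_comp[OF linop_fermion[OF this] Cons.IH] show ?case by (simp add: comp_def)
  qed (simp add: linop_def)
  define T where "T k = phi_prod rs (scale (B (- r) (- k)) (fermion (A (- k)) v))" for k
  have "has_iterated_sum (length rs) (\<lambda>ks. scale (g_prod_coeff B (ks @ [k]) (rs @ [r]))
      (foldr (\<lambda>l. fermion (A (- l))) (ks @ [k]) v)) (T k)" for k
    using snoc.IH[of "scale (B (- r) (- k)) (fermion (A (- k)) v)"] unfolding T_def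
    by (rule has_iterated_sum_cong[THEN iffD1, rotated])
      (simp add: g_prod_coeff_snoc linop_scale[OF lin])
  moreover have "has_formal_sum T UNIV (phi_prod (rs @ [r]) v)"
    using has_formal_sum_phi_prod[OF A BA] by (simp add: T_def[abs_def])
  ultimately show ?case by auto
qed

text \<open>For a fixed monomial, summability leaves finitely many lists; they lie in the finite
  product of their last entries and their initial segments, where the order of summation is
  immaterial.\<close>

lemma has_iterated_sum_imp_has_formal_sum:
  assumes "has_iterated_sum l f S" "formally_summable f {ls. length ls = l}"
  shows "has_formal_sum f {ls. length ls = l} S"
  using assms
proof (induction l arbitrary: f S)
  case 0
  then show ?case by (auto simp: has_formal_sum_def intro!: has_finite_sumI[of "{[]}"])
next
  case (Suc l)
  obtain T where T: "\<And>k. has_iterated_sum l (\<lambda>ks. f (ks @ [k])) (T k)" "has_formal_sum T UNIV S"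
    using Suc.prems(1) by auto
  have sums: "has_formal_sum (\<lambda>ks. f (ks @ [k])) {ls. length ls = l} (T k)" for k
  proof (rule Suc.IH[OF T(1)])
    show "formally_summable (\<lambda>ks. f (ks @ [k])) {ls. length ls = l}"
      unfolding formally_summable_def
    proof
      fix m
      have "(\<lambda>ks. ks @ [k]) ` {ks \<in> {ls. length ls = l}. lookup (f (ks @ [k])) m \<noteq> 0} \<subseteq>
          {ls \<in> {ls. length ls = Suc l}. lookup (f ls) m \<noteq> 0}"
        by auto
      then have "finite ((\<lambda>ks. ks @ [k]) ` {ks \<in> {ls. length ls = l}. lookup (f (ks @ [k])) m \<noteq> 0})"
        using Suc.prems(2) unfolding formally_summable_def by (meson finite_subset)
      then show "finite {ks \<in> {ls. length ls = l}. lookup (f (ks @ [k])) m \<noteq> 0}"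
        by (rule finite_imageD) (simp add: inj_on_def)
    qed
  qed
  show ?case unfolding has_formal_sum_def
  proof
    fix m
    define F where "F = {ls \<in> {ls. length ls = Suc l}. lookup (f ls) m \<noteq> 0}"
    have F: "finite F" using Suc.prems(2) by (simp add: formally_summable_def F_def)
    let ?K = "last ` F" and ?L = "butlast ` F"
    let ?snoc = "\<lambda>(k, ks). ks @ [k]"
    have snoc: "k \<in> ?K \<and> ks \<in> ?L" if "lookup (f (ks @ [k])) m \<noteq> 0" "length ks = l" for k ks
    proof -
      have "ks @ [k] \<in> F" using that by (simp add: F_def)
      then show ?thesis by (metis image_eqI butlast_snoc last_snoc)
    qed
    have Tk: "lookup (T k) m = (\<Sum>ks\<in>?L. lookup (f (ks @ [k])) m)" for k
      by (rule has_finite_sum_superset[OF sums[unfolded has_formal_sum_def, rule_format]])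
        (use F snoc in \<open>auto simp: F_def\<close>)
    have "lookup S m = (\<Sum>k\<in>?K. lookup (T k) m)"
    proof (rule has_finite_sum_superset[OF T(2)[unfolded has_formal_sum_def, rule_format]])
      show "{k \<in> UNIV. lookup (T k) m \<noteq> 0} \<subseteq> ?K"
      proof
        fix k assume "k \<in> {k \<in> UNIV. lookup (T k) m \<noteq> 0}"
        then have "(\<Sum>ks\<in>?L. lookup (f (ks @ [k])) m) \<noteq> 0" by (simp add: Tk)
        then obtain ks where ks: "ks \<in> ?L" "lookup (f (ks @ [k])) m \<noteq> 0"
          by (rule sum.not_neutral_contains_not_neutral)
        have "length ks = l" using ks(1) by (auto simp: F_def)
        then show "k \<in> ?K" by (rule conjunct1[OF snoc[OF ks(2)]])
      qed
    qed (use F in auto)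
    also have "\<dots> = (\<Sum>p\<in>?K \<times> ?L. lookup (f (?snoc p)) m)"
      by (simp add: Tk sum.cartesian_product split_def)
    also have "\<dots> = (\<Sum>ls\<in>?snoc ` (?K \<times> ?L). lookup (f ls) m)"
      by (subst sum.reindex) (auto simp: inj_on_def comp_def)
    finally have S: "lookup S m = (\<Sum>ls\<in>?snoc ` (?K \<times> ?L). lookup (f ls) m)" .
    show "has_finite_sum (\<lambda>ls. lookup (f ls) m) {ls. length ls = Suc l} (lookup S m)"
    proof (rule has_finite_sumI[OF _ _ _ S])
      show "finite (?snoc ` (?K \<times> ?L))" using F by simp
      show "?snoc ` (?K \<times> ?L) \<subseteq> {ls. length ls = Suc l}" by (auto simp: F_def)
      fix ls assume ls: "ls \<in> {ls. length ls = Suc l} - ?snoc ` (?K \<times> ?L)"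
      then obtain ks k where ks: "ls = ks @ [k]" "length ks = l"
        by (cases ls rule: rev_cases) auto
      show "lookup (f ls) m = 0"
      proof (rule ccontr)
        assume "lookup (f ls) m \<noteq> 0"
        then have "(k, ks) \<in> ?K \<times> ?L" using snoc[of ks k] ks by blast
        then have "?snoc (k, ks) \<in> ?snoc ` (?K \<times> ?L)" by (rule imageI)
        then show False using ls ks(1) by simp
      qed
    qed
  qed
qed

theorem theorem6p2:
  shows
    "(\<forall>(A :: int \<Rightarrow> int \<Rightarrow> complex) (ls :: int list). rows_bounded_below A \<longrightarrow>
        has_finite_sum (\<lambda>\<alpha>. scale (\<Prod>i < length ls. A (- (ls ! i)) (- (\<alpha> ! i))) (Q_coeff \<alpha>))
          {\<alpha>. length \<alpha> = length ls} (Q_tilde A ls)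
        \<and> (Q_tilde A ls \<noteq> 0 \<longrightarrow> BKP_tau (Q_tilde A ls)))
     \<and> (\<forall>\<tau>. BKP_tau \<tau> \<longrightarrow>
        (\<exists>A ls. rows_bounded_below A \<and> ls \<noteq> [] \<and> \<tau> = Q_tilde A ls))
     \<and> (\<forall>(A :: int \<Rightarrow> int \<Rightarrow> complex) (B :: int \<Rightarrow> int \<Rightarrow> complex) (l :: nat).
        rows_bounded_below A \<and> left_inverse B A \<longrightarrow>
        (\<forall>rs. length rs = l \<longrightarrow>
           has_iterated_sum l (\<lambda>ls. scale (g_prod_coeff B ls rs) (Q_tilde A ls)) (Q_coeff rs)
           \<and> (formally_summable (\<lambda>ls. scale (g_prod_coeff B ls rs) (Q_tilde A ls)) {ls. length ls = l}
              \<longrightarrow> has_formal_sum (\<lambda>ls. scale (g_prod_coeff B ls rs) (Q_tilde A ls))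
                    {ls. length ls = l} (Q_coeff rs)))
        \<and> (\<forall>ls. length ls = l \<and> Q_tilde A ls \<noteq> 0 \<longrightarrow> BKP_tau (Q_tilde A ls)))"
proof -
  have tau: "BKP_tau (Q_tilde A ls)" if "rows_bounded_below A" "Q_tilde A ls \<noteq> 0" for A ls
    using BKP_bilinear_Q_tilde[OF that(1)] that(2) by (simp add: BKP_tau_iff)
  have expansion: "has_finite_sum (\<lambda>\<alpha>. scale (\<Prod>i < length ls. A (- (ls ! i)) (- (\<alpha> ! i))) (Q_coeff \<alpha>))
      {\<alpha>. length \<alpha> = length ls} (Q_tilde A ls)" if "rows_bounded_below A" for A ls
    using Q_tilde_has_finite_sum[OF that, of ls] by (simp add: Q_term_def[abs_def])
  have iterated: "has_iterated_sum (length rs) (\<lambda>ls. scale (g_prod_coeff B ls rs) (Q_tilde A ls)) (Q_coeff rs)"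
    if "rows_bounded_below A" "left_inverse B A" for A B rs
    using has_iterated_sum_Q_tilde[OF that, of rs 1] by (simp add: Q_tilde_def Gamma_op_eq Q_coeff_def)
  show ?thesis
    using tau expansion iterated has_iterated_sum_imp_has_formal_sum BKP_tau_imp_Q_tilde by blast
qed

end
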